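(* Let $m\geq 1$ be an integer. For $R\in(0,\pi)$ let $\xi_{(m)}=\xi_{(m)}(R)$ be the $m$th eigenvalue (without counting multiplicity) of the first fourth-order Steklov problem on the closed geodesic disk of radius $R$ in the $2$-dimensional unit sphere $\mathbb{S}^2$. Then, as functions of $R$: (1) $\xi_{(m)}R^{3}$ is strictly increasing on $(0,\pi)$; (2) $\xi_{(m)}\sin^3 R$ is strictly decreasing on $(0,\pi)$; (3) $\xi_{(m)}\tan^3(R/2)$ is strictly increasing on $(0,\pi)$; (4) $\xi_{(m)}\sin^3(R/2)$ is strictly increasing on $(0,\pi)$.
   Context: The sphere $\mathbb{S}^2$ has constant curvature $+1$; the geodesic disk of radius $R$ carries the metric $dr^2+\sin^2 r\, g_{\mathbb{S}^1}$, $0\le r\le R$, where $r$ is the distance to the center. First fourth-order Steklov problem: on a smooth compact Riemannian manifold $M$ with boundary $\partial M$ and outward unit normal $\nu$, a real number $\xi$ is an eigenvalue if there is a nontrivial $u$ with $$\Delta^2 u=0 \text{ in } M,\qquad \frac{\partial u}{\partial\nu}=0,\quad \frac{\partial(\Delta u)}{\partial\nu}+\xi u=0 \text{ on } \partial M,$$ where $\Delta$ is the Laplace--Beltrami operator ($\Delta=\operatorname{div}\nabla$). The spectrum is discrete, nonnegative and unbounded; the distinct eigenvalues (without counting multiplicity) are listed in increasing order as $0=\xi_{(0)}<\xi_{(1)}<\xi_{(2)}<\cdots$. *)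

theory Defs
  imports "HOL-Analysis.Analysis"
begin

primrec k_smooth_on ::
  "nat \<Rightarrow> 'a::real_normed_vector set \<Rightarrow> ('a \<Rightarrow> 'b::real_normed_vector) \<Rightarrow> bool" where
  "k_smooth_on 0 S f \<longleftrightarrow> continuous_on S f"
| "k_smooth_on (Suc k) S f \<longleftrightarrow>
     (\<forall>x\<in>S. f differentiable (at x)) \<and>
     (\<forall>v. k_smooth_on k S (\<lambda>x. frechet_derivative f (at x) v))"

text \<open>Meant for open sets only: the derivatives are those of the ambient space.\<close>

definition smooth_on :: "'a::real_normed_vector set \<Rightarrow> ('a \<Rightarrow> 'b::real_normed_vector) \<Rightarrow> bool" where
  "smooth_on S f \<longleftrightarrow> (\<forall>k. k_smooth_on k S f)"

definition grad :: "('a::euclidean_space \<Rightarrow> real) \<Rightarrow> 'a \<Rightarrow> 'a" where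
  "grad u x = (\<Sum>b\<in>Basis. frechet_derivative u (at x) b *\<^sub>R b)"

text \<open>
  The unit sphere is the submanifold \<open>sphere 0 1\<close> of Euclidean 3-space with the induced metric.
  At a point \<open>x\<close> of the sphere, \<open>x\<close> is itself the unit normal of the sphere. So the Riemannian
  gradient is the tangential part of the ambient gradient, and the Riemannian divergence of a
  tangential field \<open>V\<close> is the trace of the ambient derivative of \<open>V\<close> over the tangent plane,
  that is, the full trace minus the normal contribution.

  Functions on (part of) the sphere are represented by extensions to a neighbourhood in 3-space,
  and the formulas are used verbatim off the sphere, so that they can be iterated. Off the
  sphere the values have no geometric meaning, but at points of the sphere they depend only on the
  restriction of \<open>u\<close> (resp. \<open>V\<close>) to the sphere, because only derivatives in directions tangential
  to the sphere enter.
\<close>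

definition sphere_grad :: "(real^3 \<Rightarrow> real) \<Rightarrow> real^3 \<Rightarrow> real^3" where
  "sphere_grad u x = grad u x - (grad u x \<bullet> x) *\<^sub>R x"

definition sphere_div :: "(real^3 \<Rightarrow> real^3) \<Rightarrow> real^3 \<Rightarrow> real" where
  "sphere_div V x =
     (\<Sum>b\<in>Basis. frechet_derivative V (at x) b \<bullet> b) - frechet_derivative V (at x) x \<bullet> x"

definition sphere_laplacian :: "(real^3 \<Rightarrow> real) \<Rightarrow> real^3 \<Rightarrow> real" where
  "sphere_laplacian u = sphere_div (sphere_grad u)"

text \<open>Great-circle distance, for unit vectors.\<close>

definition sphere_dist :: "real^3 \<Rightarrow> real^3 \<Rightarrow> real" where
  "sphere_dist x y = arccos (x \<bullet> y)"

definition geodesic_disk :: "real^3 \<Rightarrow> real \<Rightarrow> (real^3) set" where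
  "geodesic_disk p R = {x \<in> sphere 0 1. sphere_dist p x \<le> R}"

definition geodesic_circle :: "real^3 \<Rightarrow> real \<Rightarrow> (real^3) set" where
  "geodesic_circle p R = {x \<in> sphere 0 1. sphere_dist p x = R}"

text \<open>
  A boundary point of the disk about \<open>p\<close> is \<open>x = cos R p + sin R e\<close> with \<open>e\<close> a unit vector
  orthogonal to \<open>p\<close>. The outward unit normal is the velocity at \<open>R\<close> of the radial geodesic
  \<open>r \<mapsto> cos r p + sin r e\<close>, that is, \<open>- sin R p + cos R e\<close>, which is the following
  expression in \<open>p\<close> and \<open>x\<close>.
\<close>

definition outward_normal :: "real^3 \<Rightarrow> real \<Rightarrow> real^3 \<Rightarrow> real^3" where
  "outward_normal p R x = (cos R *\<^sub>R x - p) /\<^sub>R sin R"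

definition normal_deriv :: "real^3 \<Rightarrow> real \<Rightarrow> (real^3 \<Rightarrow> real) \<Rightarrow> real^3 \<Rightarrow> real" where
  "normal_deriv p R u x = sphere_grad u x \<bullet> outward_normal p R x"

text \<open>
  A smooth function on the closed disk (up to the boundary) is the restriction of a function that
  is smooth on an open neighbourhood of the disk in 3-space.
\<close>

definition steklov_eigenfunction :: "real^3 \<Rightarrow> real \<Rightarrow> real \<Rightarrow> (real^3 \<Rightarrow> real) \<Rightarrow> bool" where
  "steklov_eigenfunction p R \<xi> u \<longleftrightarrow>
     (\<exists>U. open U \<and> geodesic_disk p R \<subseteq> U \<and> smooth_on U u) \<and>
     (\<exists>x\<in>geodesic_disk p R. u x \<noteq> 0) \<and>
     (\<forall>x\<in>geodesic_disk p R. sphere_laplacian (sphere_laplacian u) x = 0) \<and>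
     (\<forall>x\<in>geodesic_circle p R. normal_deriv p R u x = 0) \<and>
     (\<forall>x\<in>geodesic_circle p R. normal_deriv p R (sphere_laplacian u) x + \<xi> * u x = 0)"

definition steklov_spectrum :: "real^3 \<Rightarrow> real \<Rightarrow> real set" where
  "steklov_spectrum p R = {\<xi>. \<exists>u. steklov_eigenfunction p R \<xi> u}"

text \<open>The increasing enumeration of the distinct eigenvalues, starting with index 0.\<close>

definition steklov_eigenvalue :: "real^3 \<Rightarrow> real \<Rightarrow> nat \<Rightarrow> real" where
  "steklov_eigenvalue p R = (THE f. strict_mono f \<and> range f = steklov_spectrum p R)"

end

theory Submission
  imports Defs
begin

text \<open>
  In polar coordinates about \<open>p\<close> the \<open>k\<close>-th Fourier coefficient of a biharmonic function satisfies
  an ordinary differential equation whose operator factors through \<open>sin r d/dr - k\<close>. Its regular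
  solutions are explicit with \<open>S = tan\<^sup>2 (r/2)\<close> and \<open>I\<^sub>k(S) = \<integral>\<^sub>0\<^sup>S s\<^sup>k / (1 + s)\<^sup>2 ds\<close>, and the boundary
  conditions force \<open>\<xi> = k\<^sup>2 S\<^sup>k / (2 sin R I\<^sub>k(S))\<close> at \<open>r = R\<close>. These numbers increase strictly with
  \<open>k\<close>, so they are the eigenvalues in order. The monotonicity of \<open>\<xi> sin\<^sup>3 R\<close> and \<open>\<xi> sin\<^sup>3 (R/2)\<close>
  amounts to an upper and a lower bound of \<open>I\<^sub>m\<close> by rational functions, obtained by comparing
  derivatives; the other two products are \<open>\<xi> sin\<^sup>3 (R/2)\<close> times an increasing function.
\<close>

section \<open>Smooth functions\<close>

text \<open>Because \<open>steklov_eigenvalue\<close> is a definite description, the spectrum has to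
  be determined exactly. The obstacle is the center \<open>p\<close>, where polar coordinates
  degenerate. The polar form of the Laplacian is therefore kept multiplied by
  \<open>sin\<^sup>2 r\<close>, which makes it valid at \<open>r = 0\<close>, and continuity there
  forces the first integral of the radial operator to start at zero; this discards the singular
  solutions. Conversely, an eigenfunction must be smooth in 3-space across \<open>p\<close>, where a
  formula in \<open>r\<close> shows nothing. It is built from a power series in
  \<open>1 - x \<bullet> p\<close> and the stereographic coordinate, and its eigenvalue is read off
  by applying the uniqueness argument to it, so the series is never compared with
  \<open>I\<^sub>k\<close>. The slopes \<open>a - 2\<close> and \<open>a - 1/2\<close> in the
  rational bounds, with \<open>a = m + 1\<close>, are dictated by the logarithmic derivatives of
  \<open>S^a / ((1 + S)\<^sup>2 I\<^sub>m)\<close> and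
  \<open>S^(2a) / ((1 + S) I\<^sub>m\<^sup>2)\<close>, which are \<open>\<xi> sin\<^sup>3 R\<close>
  and the square of \<open>\<xi> sin\<^sup>3 (R/2)\<close> up to constant factors.\<close>

lemma k_smooth_on_cong:
  assumes "open S" "\<And>x. x \<in> S \<Longrightarrow> f x = g x" "k_smooth_on k S f"
  shows "k_smooth_on k S g"
  using assms(2,3)
proof (induction k arbitrary: f g)
  case 0
  then show ?case
    using continuous_on_cong by force
next
  case (Suc k)
  have D: "(g has_derivative frechet_derivative f (at x)) (at x)" if "x \<in> S" for x
  proof (rule has_derivative_transform_within_open[OF _ \<open>open S\<close> that])
    show "(f has_derivative frechet_derivative f (at x)) (at x)"
      using Suc.prems(2) that frechet_derivative_works by auto
  qed (use Suc.prems in auto)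
  then have "frechet_derivative f (at x) = frechet_derivative g (at x)" if "x \<in> S" for x
    using that frechet_derivative_at by blast
  then have "k_smooth_on k S (\<lambda>x. frechet_derivative g (at x) v)" for v
    using Suc.IH[of "\<lambda>x. frechet_derivative f (at x) v" "\<lambda>x. frechet_derivative g (at x) v"]
      Suc.prems(2) by auto
  with D show ?case
    by (auto simp: differentiable_def)
qed

lemma k_smooth_on_SucI:
  assumes "open S" "\<And>x. x \<in> S \<Longrightarrow> (f has_derivative f' x) (at x)"
    and "\<And>v. k_smooth_on k S (\<lambda>x. f' x v)"
  shows "k_smooth_on (Suc k) S f"
proof -
  have "f' x = frechet_derivative f (at x)" if "x \<in> S" for x
    using assms(2)[OF that] frechet_derivative_at by blast
  then have "k_smooth_on k S (\<lambda>x. frechet_derivative f (at x) v)" for v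
    using k_smooth_on_cong[OF \<open>open S\<close> _ assms(3)[of v]] by auto
  then show ?thesis
    using assms(2) by (auto simp: differentiable_def)
qed

lemma k_smooth_on_SucD:
  "k_smooth_on (Suc k) S f \<Longrightarrow> k_smooth_on k S f"
proof (induction k arbitrary: f)
  case 0
  then show ?case
    by (auto intro!: continuous_at_imp_continuous_on differentiable_imp_continuous_within)
next
  case (Suc k)
  from Suc.prems show ?case
    by (subst k_smooth_on.simps(2), subst (asm) k_smooth_on.simps(2)) (use Suc.IH in blast)
qed

lemma k_smooth_on_Suc_has_derivative:
  "k_smooth_on (Suc k) S f \<Longrightarrow> x \<in> S \<Longrightarrow> (f has_derivative frechet_derivative f (at x)) (at x)"
  using frechet_derivative_works by auto

lemma k_smooth_on_const: "k_smooth_on k S (\<lambda>x. c)"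
  by (induction k arbitrary: c) auto

lemma k_smooth_on_bounded_linear:
  assumes "bounded_linear h" "open S" "k_smooth_on k S f"
  shows "k_smooth_on k S (\<lambda>x. h (f x))"
  using assms(3)
proof (induction k arbitrary: f)
  case 0
  then show ?case
    using bounded_linear.continuous_on[OF assms(1)] by auto
next
  case (Suc k)
  show ?case
  proof (rule k_smooth_on_SucI[OF \<open>open S\<close>])
    show "((\<lambda>x. h (f x)) has_derivative (\<lambda>v. h (frechet_derivative f (at x) v))) (at x)" if "x \<in> S" for x
      using bounded_linear.has_derivative[OF assms(1) k_smooth_on_Suc_has_derivative[OF Suc.prems that]] .
    show "k_smooth_on k S (\<lambda>x. h (frechet_derivative f (at x) v))" for v
      using Suc by auto
  qed
qed

lemma k_smooth_on_add:
  assumes "open S" "k_smooth_on k S f" "k_smooth_on k S g"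
  shows "k_smooth_on k S (\<lambda>x. f x + g x)"
  using assms(2,3)
proof (induction k arbitrary: f g)
  case 0
  then show ?case
    by (auto intro: continuous_on_add)
next
  case (Suc k)
  show ?case
  proof (rule k_smooth_on_SucI[OF \<open>open S\<close>])
    show "((\<lambda>x. f x + g x) has_derivative
        (\<lambda>v. frechet_derivative f (at x) v + frechet_derivative g (at x) v)) (at x)" if "x \<in> S" for x
      using Suc.prems that by (intro has_derivative_add k_smooth_on_Suc_has_derivative)
    show "k_smooth_on k S (\<lambda>x. frechet_derivative f (at x) v + frechet_derivative g (at x) v)" for v
      using Suc by auto
  qed
qed

lemma k_smooth_on_bounded_bilinear:
  assumes "bounded_bilinear h" "open S" "k_smooth_on k S f" "k_smooth_on k S g"
  shows "k_smooth_on k S (\<lambda>x. h (f x) (g x))"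
  using assms(3,4)
proof (induction k arbitrary: f g)
  case 0
  then show ?case
    using bounded_bilinear.continuous_on[OF assms(1)] by auto
next
  case (Suc k)
  show ?case
  proof (rule k_smooth_on_SucI[OF \<open>open S\<close>])
    show "((\<lambda>x. h (f x) (g x)) has_derivative
        (\<lambda>v. h (f x) (frechet_derivative g (at x) v) + h (frechet_derivative f (at x) v) (g x))) (at x)"
      if "x \<in> S" for x
      using Suc.prems that
      by (intro bounded_bilinear.FDERIV[OF assms(1)] k_smooth_on_Suc_has_derivative)
    show "k_smooth_on k S
        (\<lambda>x. h (f x) (frechet_derivative g (at x) v) + h (frechet_derivative f (at x) v) (g x))" for v
      \<comment> \<open>In each summand of the product rule one factor stays undifferentiated; its
        order is lowered to \<open>k\<close> so that the induction hypothesis applies.\<close>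
      using Suc.prems k_smooth_on_SucD[OF Suc.prems(1)] k_smooth_on_SucD[OF Suc.prems(2)]
      by (intro k_smooth_on_add[OF \<open>open S\<close>] Suc.IH) auto
  qed
qed

lemma smooth_on_cong:
  "open S \<Longrightarrow> (\<And>x. x \<in> S \<Longrightarrow> f x = g x) \<Longrightarrow> smooth_on S f \<Longrightarrow> smooth_on S g"
  unfolding smooth_on_def using k_smooth_on_cong by blast

lemma smooth_on_has_derivative:
  "smooth_on S f \<Longrightarrow> x \<in> S \<Longrightarrow> (f has_derivative frechet_derivative f (at x)) (at x)"
  unfolding smooth_on_def using k_smooth_on_Suc_has_derivative by blast

lemma smooth_on_frechet_derivative:
  "smooth_on S f \<Longrightarrow> smooth_on S (\<lambda>x. frechet_derivative f (at x) v)"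
  unfolding smooth_on_def using k_smooth_on.simps(2) by blast

lemma smooth_on_imp_continuous_on: "smooth_on S f \<Longrightarrow> continuous_on S f"
  unfolding smooth_on_def using k_smooth_on.simps(1) by blast

lemma smooth_on_const: "smooth_on S (\<lambda>x. c)"
  unfolding smooth_on_def using k_smooth_on_const by blast

lemma smooth_on_bounded_linear:
  "bounded_linear h \<Longrightarrow> open S \<Longrightarrow> smooth_on S f \<Longrightarrow> smooth_on S (\<lambda>x. h (f x))"
  unfolding smooth_on_def using k_smooth_on_bounded_linear by blast

lemma smooth_on_add:
  "open S \<Longrightarrow> smooth_on S f \<Longrightarrow> smooth_on S g \<Longrightarrow> smooth_on S (\<lambda>x. f x + g x)"
  unfolding smooth_on_def using k_smooth_on_add by blast

lemma smooth_on_bounded_bilinear: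
  "bounded_bilinear h \<Longrightarrow> open S \<Longrightarrow> smooth_on S f \<Longrightarrow> smooth_on S g \<Longrightarrow> smooth_on S (\<lambda>x. h (f x) (g x))"
  unfolding smooth_on_def using k_smooth_on_bounded_bilinear by blast

lemma smooth_on_diff:
  assumes "open S" "smooth_on S f" "smooth_on S g"
  shows "smooth_on S (\<lambda>x. f x - g x)"
  using smooth_on_add[OF assms(1,2) smooth_on_bounded_linear[OF _ assms(1,3), of uminus]]
    bounded_linear_minus[OF bounded_linear_ident] by simp

lemma smooth_on_sum:
  assumes "open S" "\<And>i. i \<in> I \<Longrightarrow> smooth_on S (f i)"
  shows "smooth_on S (\<lambda>x. \<Sum>i\<in>I. f i x)"
  using assms(2)
  by (induction I rule: infinite_finite_induct) (auto intro: smooth_on_const smooth_on_add[OF \<open>open S\<close>])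

lemma smooth_on_ident:
  assumes "open S"
  shows "smooth_on S (\<lambda>x. x)"
  unfolding smooth_on_def
proof
  show "k_smooth_on k S (\<lambda>x. x)" for k
    by (cases k) (auto intro!: k_smooth_on_SucI[OF assms, where f'="\<lambda>x v. v"] k_smooth_on_const
        continuous_on_id simp del: k_smooth_on.simps(2))
qed

lemmas smooth_on_mult = smooth_on_bounded_bilinear[OF bounded_bilinear_mult]
  and smooth_on_scaleR = smooth_on_bounded_bilinear[OF bounded_bilinear_scaleR]
  and smooth_on_inner = smooth_on_bounded_bilinear[OF bounded_bilinear_inner]

lemma smooth_on_power:
  fixes f :: "'a::real_normed_vector \<Rightarrow> 'b::real_normed_algebra_1"
  assumes "open S" "smooth_on S f"
  shows "smooth_on S (\<lambda>x. f x ^ n)"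
  by (induction n) (auto intro: smooth_on_const smooth_on_mult assms)

text \<open>All derivatives are supplied at once as a sequence \<open>f j\<close>: a directional
  derivative of \<open>f j (L x)\<close> is a multiple of \<open>f (Suc j) (L x)\<close>, so one
  induction on the order, for arbitrary \<open>j\<close>, suffices.\<close>

lemma smooth_on_compose_bounded_linear:
  fixes f :: "nat \<Rightarrow> real \<Rightarrow> real"
  assumes "bounded_linear L" "open S"
    and D: "\<And>j x. x \<in> S \<Longrightarrow> (f j has_real_derivative f (Suc j) (L x)) (at (L x))"
  shows "smooth_on S (\<lambda>x. f 0 (L x))"
proof -
  have deriv: "((\<lambda>x. f j (L x)) has_derivative (\<lambda>v. L v * f (Suc j) (L x))) (at x)" if "x \<in> S" for j x
    using has_derivative_compose[OF bounded_linear_imp_has_derivative[OF assms(1)]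
        D[OF that, of j, unfolded has_field_derivative_def]] by (simp add: mult.commute)
  have "k_smooth_on k S (\<lambda>x. f j (L x))" for k j
  proof (induction k arbitrary: j)
    case 0
    show ?case
      using deriv by (auto intro!: continuous_at_imp_continuous_on has_derivative_continuous)
  next
    case (Suc k)
    show ?case
    proof (rule k_smooth_on_SucI[OF \<open>open S\<close> deriv])
      show "k_smooth_on k S (\<lambda>x. L v * f (Suc j) (L x))" for v
        using k_smooth_on_bounded_linear[OF bounded_linear_mult_right \<open>open S\<close> Suc.IH] .
    qed
  qed
  then show ?thesis
    unfolding smooth_on_def by blast
qed

section \<open>The Laplacian of the sphere in ambient terms\<close>

lemma frechet_derivative_Basis_sum:
  fixes f :: "'a::euclidean_space \<Rightarrow> 'b::real_normed_vector"
  assumes "f differentiable (at x)"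
  shows "frechet_derivative f (at x) v = (\<Sum>b\<in>Basis. (v \<bullet> b) *\<^sub>R frechet_derivative f (at x) b)"
proof -
  have lin: "linear (frechet_derivative f (at x))"
    using assms linear_frechet_derivative by blast
  have "frechet_derivative f (at x) v = frechet_derivative f (at x) (\<Sum>b\<in>Basis. (v \<bullet> b) *\<^sub>R b)"
    by (simp add: euclidean_representation)
  also have "\<dots> = (\<Sum>b\<in>Basis. (v \<bullet> b) *\<^sub>R frechet_derivative f (at x) b)"
    by (simp add: linear_sum[OF lin] linear_scale[OF lin])
  finally show ?thesis .
qed

lemma smooth_on_grad:
  assumes "open S" "smooth_on S u"
  shows "smooth_on S (grad u)"
  unfolding grad_def[abs_def]
  by (intro smooth_on_sum smooth_on_scaleR smooth_on_frechet_derivative smooth_on_const assms)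

lemma frechet_derivative_eq_grad:
  assumes "u differentiable (at x)"
  shows "frechet_derivative u (at x) v = grad u x \<bullet> v"
  using frechet_derivative_Basis_sum[OF assms, of v]
  by (simp add: grad_def inner_sum_left inner_sum_right mult.commute inner_commute)

lemma smooth_on_sphere_grad:
  assumes "open S" "smooth_on S u"
  shows "smooth_on S (sphere_grad u)"
  unfolding sphere_grad_def[abs_def]
  by (intro smooth_on_diff smooth_on_scaleR smooth_on_inner smooth_on_grad smooth_on_ident assms)

text \<open>The normal term of the divergence differentiates in the direction \<open>x\<close>,
  which moves with the point, whereas smoothness speaks of fixed directions; expanding
  \<open>x\<close> in \<open>Basis\<close> bridges this.\<close>

lemma smooth_on_sphere_laplacian:
  assumes "open S" "smooth_on S u"
  shows "smooth_on S (sphere_laplacian u)"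
proof -
  let ?V = "sphere_grad u"
  have V: "smooth_on S ?V"
    using smooth_on_sphere_grad[OF assms] .
  have "smooth_on S (\<lambda>x. (\<Sum>b\<in>Basis. frechet_derivative ?V (at x) b \<bullet> b)
      - (\<Sum>b\<in>Basis. (x \<bullet> b) *\<^sub>R frechet_derivative ?V (at x) b) \<bullet> x)"
    by (intro smooth_on_diff smooth_on_sum smooth_on_scaleR smooth_on_inner
        smooth_on_frechet_derivative smooth_on_ident smooth_on_const V assms)
  then show ?thesis
  proof (rule smooth_on_cong[OF assms(1), rotated])
    fix x assume "x \<in> S"
    then have "?V differentiable (at x)"
      using smooth_on_has_derivative[OF V] differentiable_def by blast
    from frechet_derivative_Basis_sum[OF this, of x]
    show "(\<Sum>b\<in>Basis. frechet_derivative ?V (at x) b \<bullet> b)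
      - (\<Sum>b\<in>Basis. (x \<bullet> b) *\<^sub>R frechet_derivative ?V (at x) b) \<bullet> x = sphere_laplacian u x"
      by (simp add: sphere_laplacian_def sphere_div_def)
  qed
qed

text \<open>Hessian terms aside, differentiating the subtracted radial field contributes
  \<open>- 4\<close> normal derivatives to the full trace and \<open>- 2\<close> to its normal part;
  the difference is the mean curvature term with factor \<open>2\<close>.\<close>

lemma sphere_laplacian_eq:
  fixes u :: "real^3 \<Rightarrow> real"
  assumes "open S" "smooth_on S u" "x \<in> S" "norm x = 1"
  defines "H \<equiv> frechet_derivative (grad u) (at x)"
  shows "sphere_laplacian u x = (\<Sum>b\<in>Basis. H b \<bullet> b) - H x \<bullet> x - 2 * (grad u x \<bullet> x)"
proof -
  let ?g = "grad u x"
  have H: "(grad u has_derivative H) (at x)"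
    unfolding H_def using smooth_on_has_derivative[OF smooth_on_grad] assms by blast
  then have lin: "linear H"
    using has_derivative_linear by blast
  have "(sphere_grad u has_derivative (\<lambda>v. H v - ((?g \<bullet> x) *\<^sub>R v + (?g \<bullet> v + H v \<bullet> x) *\<^sub>R x))) (at x)"
    unfolding sphere_grad_def[abs_def]
    by (intro derivative_intros H has_derivative_inner has_derivative_scaleR)
  then have D: "frechet_derivative (sphere_grad u) (at x)
      = (\<lambda>v. H v - ((?g \<bullet> x) *\<^sub>R v + (?g \<bullet> v + H v \<bullet> x) *\<^sub>R x))"
    by (rule frechet_derivative_at[symmetric])
  have xx: "x \<bullet> x = 1"
    using assms(4) by (simp add: dot_square_norm)
  have gb: "(\<Sum>b\<in>Basis. (?g \<bullet> b) * (x \<bullet> b)) = ?g \<bullet> x"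
    using euclidean_inner[of ?g x] by simp
  have "(\<Sum>b\<in>Basis. (H b \<bullet> x) * (x \<bullet> b)) = H (\<Sum>b\<in>Basis. (x \<bullet> b) *\<^sub>R b) \<bullet> x"
    by (simp add: linear_sum[OF lin] linear_scale[OF lin] inner_sum_left mult.commute)
  then have hb: "(\<Sum>b\<in>Basis. (H b \<bullet> x) * (x \<bullet> b)) = H x \<bullet> x"
    by (simp add: euclidean_representation)
  have card: "card (Basis :: (real^3) set) = 3"
    by simp
  have one: "(\<Sum>b\<in>(Basis::(real^3) set). (?g \<bullet> x) * (b \<bullet> b)) = 3 * (?g \<bullet> x)"
    by (simp add: inner_same_Basis card)
  have "(\<Sum>b\<in>Basis. frechet_derivative (sphere_grad u) (at x) b \<bullet> b)
      = (\<Sum>b\<in>Basis. H b \<bullet> b - ((?g \<bullet> x) * (b \<bullet> b) + ((?g \<bullet> b) * (x \<bullet> b) + (H b \<bullet> x) * (x \<bullet> b))))"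
    unfolding D inner_diff_left inner_add_left inner_scaleR_left distrib_right by (rule refl)
  also have "\<dots> = (\<Sum>b\<in>Basis. H b \<bullet> b) - 4 * (?g \<bullet> x) - H x \<bullet> x"
    unfolding sum_subtractf sum.distrib one gb hb by simp
  finally have tr: "(\<Sum>b\<in>Basis. frechet_derivative (sphere_grad u) (at x) b \<bullet> b)
      = (\<Sum>b\<in>Basis. H b \<bullet> b) - 4 * (?g \<bullet> x) - H x \<bullet> x" .
  have "frechet_derivative (sphere_grad u) (at x) x \<bullet> x = - 2 * (?g \<bullet> x)"
    unfolding D inner_diff_left inner_add_left inner_scaleR_left distrib_right xx by simp
  with tr show ?thesis
    by (simp add: sphere_laplacian_def sphere_div_def)
qed

section \<open>Geodesic polar coordinates\<close>

lemma orthonormal_triple_expand: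
  fixes a b c :: "real^3"
  assumes "a \<bullet> a = 1" "b \<bullet> b = 1" "c \<bullet> c = 1" "a \<bullet> b = 0" "a \<bullet> c = 0" "b \<bullet> c = 0"
  shows "v = (v \<bullet> a) *\<^sub>R a + (v \<bullet> b) *\<^sub>R b + (v \<bullet> c) *\<^sub>R c"
proof -
  let ?B = "{a, b, c}"
  have neq: "a \<noteq> b" "a \<noteq> c" "b \<noteq> c"
    using assms by auto
  have orth: "pairwise orthogonal ?B"
    using assms by (auto simp: pairwise_def orthogonal_def inner_commute)
  have "0 \<notin> ?B"
    using assms by auto
  then have "independent ?B"
    using pairwise_orthogonal_independent orth by blast
  then have "UNIV \<subseteq> span ?B"
    using neq by (intro card_ge_dim_independent) auto
  then have "(\<Sum>i\<in>?B. (v \<bullet> i) *\<^sub>R i) = v"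
    using assms by (intro orthonormal_basis_expand orth) (auto simp: norm_eq_1)
  then show ?thesis
    using neq by (simp add: add.assoc)
qed

text \<open>Basis independence of the trace, so that the Laplacian can be evaluated in the moving
  frame at a polar point. Each standard basis vector is expanded in the triple and the sum regrouped
  by \<open>euclidean_inner\<close>.\<close>

lemma orthonormal_triple_trace:
  fixes a b c :: "real^3"
  assumes "a \<bullet> a = 1" "b \<bullet> b = 1" "c \<bullet> c = 1" "a \<bullet> b = 0" "a \<bullet> c = 0" "b \<bullet> c = 0"
    and lin: "linear H"
  shows "(\<Sum>i\<in>Basis. H i \<bullet> i) = H a \<bullet> a + H b \<bullet> b + H c \<bullet> c"
proof -
  have eq: "H i \<bullet> i = (H a \<bullet> i) * (a \<bullet> i) + (H b \<bullet> i) * (b \<bullet> i) + (H c \<bullet> i) * (c \<bullet> i)" for i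
  proof -
    have "H i = H ((i \<bullet> a) *\<^sub>R a + (i \<bullet> b) *\<^sub>R b + (i \<bullet> c) *\<^sub>R c)"
      using orthonormal_triple_expand[OF assms(1-6), of i] by simp
    also have "\<dots> = (i \<bullet> a) *\<^sub>R H a + (i \<bullet> b) *\<^sub>R H b + (i \<bullet> c) *\<^sub>R H c"
      by (simp add: linear_add[OF lin] linear_scale[OF lin])
    finally have "H i \<bullet> i = (i \<bullet> a) * (H a \<bullet> i) + (i \<bullet> b) * (H b \<bullet> i) + (i \<bullet> c) * (H c \<bullet> i)"
      by (simp only: inner_add_left inner_scaleR_left)
    then show ?thesis
      by (simp only: inner_commute[of i a] inner_commute[of i b] inner_commute[of i c] mult.commute)
  qed
  show ?thesis
    unfolding euclidean_inner[of "H a" a] euclidean_inner[of "H b" b] euclidean_inner[of "H c" c]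
      sum.distrib[symmetric]
    by (rule sum.cong[OF refl eq])
qed

text \<open>The quadratic form of the ambient, not the covariant, second derivative; along a great
  circle the two differ by the normal derivative, as seen in \<open>deriv_rr\<close>.\<close>

definition hess :: "('a::euclidean_space \<Rightarrow> real) \<Rightarrow> 'a \<Rightarrow> 'a \<Rightarrow> real" where
  "hess u x v = frechet_derivative (grad u) (at x) v \<bullet> v"

locale sphere_frame =
  fixes p e1 e2 :: "real^3"
  assumes frame [simp]: "p \<bullet> p = 1" "e1 \<bullet> e1 = 1" "e2 \<bullet> e2 = 1"
    "p \<bullet> e1 = 0" "p \<bullet> e2 = 0" "e1 \<bullet> e2 = 0"
begin

lemma frame_sym [simp]: "e1 \<bullet> p = 0" "e2 \<bullet> p = 0" "e2 \<bullet> e1 = 0"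
  using frame by (simp_all add: inner_commute)

definition dir :: "real \<Rightarrow> real^3" where
  "dir t = cos t *\<^sub>R e1 + sin t *\<^sub>R e2"

definition dir' :: "real \<Rightarrow> real^3" where
  "dir' t = - sin t *\<^sub>R e1 + cos t *\<^sub>R e2"

definition polar :: "real \<Rightarrow> real \<Rightarrow> real^3" where
  "polar r t = cos r *\<^sub>R p + sin r *\<^sub>R dir t"

definition polar_r :: "real \<Rightarrow> real \<Rightarrow> real^3" where
  "polar_r r t = - sin r *\<^sub>R p + cos r *\<^sub>R dir t"

lemma cos_sin_square: "cos t * cos t + sin t * sin t = (1::real)"
  by (metis power2_eq_square sin_cos_squared_add2)

lemma dir_inner [simp]: "dir t \<bullet> dir t = 1" "dir' t \<bullet> dir' t = 1" "dir t \<bullet> dir' t = 0" "dir' t \<bullet> dir t = 0"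
    "p \<bullet> dir t = 0" "p \<bullet> dir' t = 0" "dir t \<bullet> p = 0" "dir' t \<bullet> p = 0"
  using cos_sin_square[of t]
  by (simp_all add: dir_def dir'_def inner_add_left inner_add_right inner_diff_left inner_diff_right)

lemma polar_inner [simp]: "polar r t \<bullet> polar r t = 1" "polar_r r t \<bullet> polar_r r t = 1"
    "polar r t \<bullet> polar_r r t = 0" "polar r t \<bullet> dir' t = 0" "polar_r r t \<bullet> dir' t = 0"
    "p \<bullet> polar r t = cos r"
  using cos_sin_square[of r]
  by (simp_all add: polar_def polar_r_def inner_add_left inner_add_right inner_diff_left
      inner_diff_right)

lemma norm_polar [simp]: "norm (polar r t) = 1"
  by (simp add: norm_eq_1)

lemma dir_has_vector_derivative [derivative_intros]:
  "(dir has_vector_derivative dir' t) (at t within A)"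
  unfolding dir_def[abs_def] dir'_def
  by (auto intro!: derivative_eq_intros simp: has_vector_derivative_def scaleR_left.add algebra_simps)

lemma dir'_has_vector_derivative [derivative_intros]:
  "(dir' has_vector_derivative - dir t) (at t within A)"
  unfolding dir_def dir'_def[abs_def]
  by (auto intro!: derivative_eq_intros simp: has_vector_derivative_def algebra_simps)

lemma polar_has_vector_derivative_r:
  "((\<lambda>r. polar r t) has_vector_derivative polar_r r t) (at r within A)"
  unfolding polar_def polar_r_def
  by (auto intro!: derivative_eq_intros simp: has_vector_derivative_def algebra_simps)

lemma polar_r_has_vector_derivative_r:
  "((\<lambda>r. polar_r r t) has_vector_derivative - polar r t) (at r within A)"
  unfolding polar_def polar_r_def
  by (auto intro!: derivative_eq_intros simp: has_vector_derivative_def algebra_simps)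

lemma polar_has_vector_derivative_t:
  "((\<lambda>t. polar r t) has_vector_derivative sin r *\<^sub>R dir' t) (at t within A)"
proof -
  have "((\<lambda>t. cos r *\<^sub>R p + sin r *\<^sub>R dir t) has_vector_derivative 0 + sin r *\<^sub>R dir' t) (at t within A)"
    by (intro has_vector_derivative_add has_vector_derivative_const bounded_linear.has_vector_derivative
        [OF bounded_linear_scaleR_right] dir_has_vector_derivative)
  then show ?thesis
    by (simp add: polar_def)
qed

lemma continuous_on_dir [continuous_intros]:
  fixes f :: "'a::t2_space \<Rightarrow> real"
  shows "continuous_on A f \<Longrightarrow> continuous_on A (\<lambda>x. dir (f x))"
  unfolding dir_def by (intro continuous_intros)

lemma continuous_on_polar [continuous_intros]:
  fixes f :: "'a::t2_space \<Rightarrow> real"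
  shows "continuous_on A f \<Longrightarrow> continuous_on A g \<Longrightarrow> continuous_on A (\<lambda>x. polar (f x) (g x))"
  unfolding polar_def by (intro continuous_intros)

lemma continuous_on_polar_r [continuous_intros]:
  fixes f :: "'a::t2_space \<Rightarrow> real"
  shows "continuous_on A f \<Longrightarrow> continuous_on A g \<Longrightarrow> continuous_on A (\<lambda>x. polar_r (f x) (g x))"
  unfolding polar_r_def by (intro continuous_intros)

lemma frame_expand: "v = (v \<bullet> p) *\<^sub>R p + (v \<bullet> e1) *\<^sub>R e1 + (v \<bullet> e2) *\<^sub>R e2"
  by (rule orthonormal_triple_expand) simp_all

lemma sphere_dist_polar: "0 \<le> r \<Longrightarrow> r \<le> pi \<Longrightarrow> sphere_dist p (polar r t) = r"
  by (simp add: sphere_dist_def arccos_cos)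

lemma sphere_eq_polar:
  assumes "x \<in> sphere 0 1"
  obtains t where "0 \<le> t" "t \<le> 2 * pi" "x = polar (sphere_dist p x) t"
proof -
  define r where "r = sphere_dist p x"
  have nx: "norm x = 1"
    using assms by simp
  have "\<bar>p \<bullet> x\<bar> \<le> norm p * norm x"
    by (rule Cauchy_Schwarz_ineq2)
  then have "\<bar>p \<bullet> x\<bar> \<le> 1"
    using nx by (simp add: norm_eq_sqrt_inner[of p])
  then have cos: "cos r = p \<bullet> x" and r: "0 \<le> r" "r \<le> pi"
    by (auto simp: r_def sphere_dist_def cos_arccos_abs arccos_lbound arccos_ubound abs_le_iff)
  have sin: "0 \<le> sin r"
    using r by (intro sin_ge_zero)
  have "x \<bullet> x = 1"
    using nx by (simp add: norm_eq_1)
  moreover have "x \<bullet> x = (x \<bullet> p)\<^sup>2 + (x \<bullet> e1)\<^sup>2 + (x \<bullet> e2)\<^sup>2"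
    by (subst (2) frame_expand[of x]) (simp add: inner_add_right power2_eq_square)
  ultimately have sq: "(x \<bullet> e1)\<^sup>2 + (x \<bullet> e2)\<^sup>2 = (sin r)\<^sup>2"
    using sin_cos_squared_add[of r] by (simp add: cos inner_commute)
  have "\<exists>t\<ge>0. t \<le> 2 * pi \<and> x \<bullet> e1 = sin r * cos t \<and> x \<bullet> e2 = sin r * sin t"
  proof (cases "sin r = 0")
    \<comment> \<open>At \<open>p\<close> and \<open>- p\<close> the angle is arbitrary.\<close>
    case True
    then have "x \<bullet> e1 = 0" "x \<bullet> e2 = 0"
      using sq by (auto simp: sum_power2_eq_zero_iff)
    with True show ?thesis
      by (intro exI[of _ 0]) auto
  next
    case False
    then have "(x \<bullet> e1 / sin r)\<^sup>2 + (x \<bullet> e2 / sin r)\<^sup>2 = 1"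
      using sq by (simp add: power_divide flip: add_divide_distrib)
    from sincos_total_2pi[OF this] obtain t where
      "0 \<le> t" "t < 2 * pi" "x \<bullet> e1 / sin r = cos t" "x \<bullet> e2 / sin r = sin t" .
    then show ?thesis
      using False by (intro exI[of _ t]) (auto simp: field_simps)
  qed
  then obtain t where t: "0 \<le> t" "t \<le> 2 * pi" "x \<bullet> e1 = sin r * cos t" "x \<bullet> e2 = sin r * sin t"
    by blast
  have "polar r t = (x \<bullet> p) *\<^sub>R p + (x \<bullet> e1) *\<^sub>R e1 + (x \<bullet> e2) *\<^sub>R e2"
    by (simp add: polar_def dir_def t(3,4) cos inner_commute[of x p] scaleR_add_right add.assoc)
  also have "\<dots> = x"
    by (rule frame_expand[symmetric])
  finally have "x = polar r t" ..
  then show ?thesis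
    unfolding r_def by (rule that[OF t(1,2)])
qed

lemma polar_in_disk: "0 \<le> r \<Longrightarrow> r \<le> R \<Longrightarrow> R < pi \<Longrightarrow> polar r t \<in> geodesic_disk p R"
  by (simp add: geodesic_disk_def sphere_dist_polar)

lemma polar_in_circle: "0 \<le> R \<Longrightarrow> R < pi \<Longrightarrow> polar R t \<in> geodesic_circle p R"
  by (simp add: geodesic_circle_def sphere_dist_polar)

lemma geodesic_disk_polarE:
  assumes "x \<in> geodesic_disk p R"
  obtains r t where "0 \<le> r" "r \<le> R" "0 \<le> t" "t \<le> 2 * pi" "x = polar r t"
proof -
  have x: "x \<in> sphere 0 1" "sphere_dist p x \<le> R"
    using assms by (auto simp: geodesic_disk_def)
  obtain t where t: "0 \<le> t" "t \<le> 2 * pi" "x = polar (sphere_dist p x) t"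
    using sphere_eq_polar[OF x(1)] .
  have "\<bar>p \<bullet> x\<bar> \<le> norm p * norm x"
    by (rule Cauchy_Schwarz_ineq2)
  then have "0 \<le> sphere_dist p x"
    using x(1) by (simp add: sphere_dist_def norm_eq_sqrt_inner[of p] arccos_lbound abs_le_iff)
  with t x(2) that show ?thesis
    by blast
qed

lemma geodesic_circle_polarE:
  assumes "x \<in> geodesic_circle p R"
  obtains t where "0 \<le> t" "t \<le> 2 * pi" "x = polar R t"
  using assms sphere_eq_polar[of x] that by (auto simp: geodesic_circle_def)

lemma outward_normal_polar:
  assumes "sin R \<noteq> 0"
  shows "outward_normal p R (polar R t) = polar_r R t"
proof -
  have "cos R *\<^sub>R polar R t - p = sin R *\<^sub>R polar_r R t"
  proof -
    have "cos R *\<^sub>R polar R t - p = (cos R * cos R - 1) *\<^sub>R p + (cos R * sin R) *\<^sub>R dir t"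
      by (simp add: polar_def scaleR_add_right scaleR_diff_left)
    also have "cos R * cos R - 1 = - (sin R * sin R)"
      using cos_sin_square[of R] by linarith
    finally show ?thesis
      by (simp add: polar_r_def scaleR_add_right scaleR_diff_right mult.commute)
  qed
  then show ?thesis
    using assms by (simp add: outward_normal_def)
qed

text \<open>The outward normal is tangent to the sphere, so the projection in
  \<open>sphere_grad\<close> drops out.\<close>

lemma normal_deriv_polar:
  assumes "sin R \<noteq> 0"
  shows "normal_deriv p R u (polar R t) = grad u (polar R t) \<bullet> polar_r R t"
  using assms by (simp add: normal_deriv_def outward_normal_polar sphere_grad_def inner_diff_left)

context
  fixes S :: "(real^3) set" and u :: "real^3 \<Rightarrow> real"
  assumes S: "open S" and u: "smooth_on S u"
begin

lemma has_vector_derivative_compose_grad: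
  assumes "(X has_vector_derivative X') (at s within A)" "X s \<in> S"
  shows "((\<lambda>s. u (X s)) has_real_derivative grad u (X s) \<bullet> X') (at s within A)"
proof -
  have D: "(u has_derivative frechet_derivative u (at (X s))) (at (X s))"
    using smooth_on_has_derivative[OF u assms(2)] .
  then have "frechet_derivative u (at (X s)) v = grad u (X s) \<bullet> v" for v
    using frechet_derivative_eq_grad differentiable_def by blast
  then have "frechet_derivative u (at (X s)) = (\<lambda>v. grad u (X s) \<bullet> v)"
    by blast
  with D have "(u has_derivative (\<lambda>v. grad u (X s) \<bullet> v)) (at (X s))"
    by simp
  from has_derivative_compose[OF assms(1)[unfolded has_vector_derivative_def] this]
  show ?thesis
    by (simp add: has_field_derivative_def mult_commute_abs)
qed

lemma grad_has_vector_derivative_compose: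
  assumes "(X has_vector_derivative X') (at s within A)" "X s \<in> S"
  shows "((\<lambda>s. grad u (X s)) has_vector_derivative frechet_derivative (grad u) (at (X s)) X') (at s within A)"
proof -
  have D: "(grad u has_derivative frechet_derivative (grad u) (at (X s))) (at (X s))"
    using smooth_on_has_derivative[OF smooth_on_grad[OF S u] assms(2)] .
  from has_derivative_compose[OF assms(1)[unfolded has_vector_derivative_def] this]
  show ?thesis
    using linear_scale[OF has_derivative_linear[OF D]]
    by (simp add: has_vector_derivative_def)
qed

lemma inner_grad_has_derivative:
  assumes "(X has_vector_derivative X') (at s within A)" "X s \<in> S"
    and "(V has_vector_derivative V') (at s within A)"
  shows "((\<lambda>s. grad u (X s) \<bullet> V s) has_real_derivative
    frechet_derivative (grad u) (at (X s)) X' \<bullet> V s + grad u (X s) \<bullet> V') (at s within A)"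
  using has_derivative_inner[OF
      grad_has_vector_derivative_compose[OF assms(1,2), unfolded has_vector_derivative_def]
      assms(3)[unfolded has_vector_derivative_def]]
  by (rule has_derivative_imp_has_field_derivative) (simp add: algebra_simps)

lemma deriv_r:
  "polar r t \<in> S \<Longrightarrow>
   ((\<lambda>r. u (polar r t)) has_real_derivative grad u (polar r t) \<bullet> polar_r r t) (at r within A)"
  by (rule has_vector_derivative_compose_grad[OF polar_has_vector_derivative_r])

lemma deriv_rr:
  "polar r t \<in> S \<Longrightarrow>
   ((\<lambda>r. grad u (polar r t) \<bullet> polar_r r t) has_real_derivative
     hess u (polar r t) (polar_r r t) - grad u (polar r t) \<bullet> polar r t) (at r within A)"
  using inner_grad_has_derivative[OF polar_has_vector_derivative_r _ polar_r_has_vector_derivative_r]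
  by (simp add: hess_def)

lemma deriv_t:
  "polar r t \<in> S \<Longrightarrow>
   ((\<lambda>t. u (polar r t)) has_real_derivative sin r * (grad u (polar r t) \<bullet> dir' t)) (at t within A)"
  using has_vector_derivative_compose_grad[OF polar_has_vector_derivative_t] by simp

lemma deriv_tt:
  assumes "polar r t \<in> S"
  shows "((\<lambda>t. sin r * (grad u (polar r t) \<bullet> dir' t)) has_real_derivative
     sin r * (sin r * hess u (polar r t) (dir' t) - grad u (polar r t) \<bullet> dir t)) (at t within A)"
proof -
  have D: "(grad u has_derivative frechet_derivative (grad u) (at (polar r t))) (at (polar r t))"
    using smooth_on_has_derivative[OF smooth_on_grad[OF S u] assms] .
  show ?thesis
    using DERIV_cmult[OF inner_grad_has_derivative[OF polar_has_vector_derivative_t assms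
        dir'_has_vector_derivative], of "sin r"]
    by (simp add: hess_def linear_scale[OF has_derivative_linear[OF D]])
qed

text \<open>The Laplacian is a trace over the orthonormal frame \<open>polar\<close>,
  \<open>polar_r\<close>, \<open>dir'\<close>. The angular second derivative brings in
  \<open>dir t\<close>, which is \<open>cos r\<close> times \<open>polar_r\<close> plus
  \<open>sin r\<close> times \<open>polar\<close>; these two parts match the first-order radial term
  and the curvature term. Keeping the factor \<open>sin\<^sup>2 r\<close> includes the
  center.\<close>

lemma laplacian_polar:
  assumes "polar r t \<in> S"
  shows "(sin r)\<^sup>2 * (hess u (polar r t) (polar_r r t) - grad u (polar r t) \<bullet> polar r t)
      + sin r * cos r * (grad u (polar r t) \<bullet> polar_r r t)
      + sin r * (sin r * hess u (polar r t) (dir' t) - grad u (polar r t) \<bullet> dir t)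
    = (sin r)\<^sup>2 * sphere_laplacian u (polar r t)"
proof -
  let ?g = "grad u (polar r t)" and ?H = "frechet_derivative (grad u) (at (polar r t))"
  have lin: "linear ?H"
    using smooth_on_has_derivative[OF smooth_on_grad[OF S u] assms] has_derivative_linear by blast
  have tr: "sphere_laplacian u (polar r t)
      = hess u (polar r t) (polar_r r t) + hess u (polar r t) (dir' t) - 2 * (?g \<bullet> polar r t)"
    using sphere_laplacian_eq[OF S u assms norm_polar]
      orthonormal_triple_trace[of "polar r t" "polar_r r t" "dir' t" ?H] lin
    by (simp add: hess_def)
  have "cos r *\<^sub>R polar_r r t - dir t = - sin r *\<^sub>R polar r t"
  proof -
    have "cos r *\<^sub>R polar_r r t - dir t = - (sin r * cos r) *\<^sub>R p + (cos r * cos r - 1) *\<^sub>R dir t"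
      by (simp add: polar_r_def scaleR_diff_right scaleR_diff_left mult.commute)
    also have "cos r * cos r - 1 = - (sin r * sin r)"
      using cos_sin_square[of r] by linarith
    finally show ?thesis
      by (simp add: polar_def scaleR_add_right)
  qed
  then have "?g \<bullet> (cos r *\<^sub>R polar_r r t - dir t) = ?g \<bullet> (- sin r *\<^sub>R polar r t)"
    by simp
  then have d: "?g \<bullet> dir t = cos r * (?g \<bullet> polar_r r t) + sin r * (?g \<bullet> polar r t)"
    by (simp add: inner_diff_right)
  show ?thesis
    unfolding tr d by algebra
qed

end

end

lemma sphere_frame_exists:
  assumes "p \<in> sphere 0 1"
  obtains e1 e2 where "sphere_frame p e1 e2"
proof -
  have "norm p = 1"
    using assms by simp
  then obtain B where B: "p \<in> B" "pairwise orthogonal B" "\<And>x. x \<in> B \<Longrightarrow> norm x = 1"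
      "card B = DIM(real^3)"
    using vector_in_orthonormal_basis[of p] by metis
  then have "card (B - {p}) = 2"
    by simp
  then obtain e1 e2 where e: "B - {p} = {e1, e2}" "e1 \<noteq> e2"
    by (meson card_2_iff)
  then have "e1 \<in> B" "e2 \<in> B" "e1 \<noteq> p" "e2 \<noteq> p"
    by auto
  then have "sphere_frame p e1 e2"
    using B e(2) by unfold_locales (auto simp: pairwise_def orthogonal_def norm_eq_1)
  then show ?thesis
    by (rule that)
qed

section \<open>The radial equation\<close>

definition steklov_integral :: "nat \<Rightarrow> real \<Rightarrow> real" where
  "steklov_integral k S = integral {0..S} (\<lambda>s. s ^ k / (1 + s)\<^sup>2)"

text \<open>The eigenvalue of angular frequency \<open>k\<close>, in terms of \<open>S = tan\<^sup>2 (R/2)\<close>.\<close>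

definition steklov_xi :: "nat \<Rightarrow> real \<Rightarrow> real" where
  "steklov_xi k R = (real k)\<^sup>2 * ((tan (R / 2))\<^sup>2) ^ k / (2 * sin R * steklov_integral k ((tan (R / 2))\<^sup>2))"

lemma steklov_integrand_continuous: "continuous_on {0..} (\<lambda>s::real. s ^ k / (1 + s)\<^sup>2)"
  by (intro continuous_intros) auto

lemma steklov_integral_0 [simp]: "steklov_integral k 0 = 0"
  by (simp add: steklov_integral_def)

lemma steklov_integral_deriv_within:
  assumes "0 \<le> S" "S \<le> b"
  shows "(steklov_integral k has_real_derivative S ^ k / (1 + S)\<^sup>2) (at S within {0..b})"
  unfolding steklov_integral_def[abs_def]
  by (rule integral_has_real_derivative)
    (use assms in \<open>auto intro: continuous_on_subset[OF steklov_integrand_continuous]\<close>)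

lemma steklov_integral_deriv:
  assumes "0 < S"
  shows "(steklov_integral k has_real_derivative S ^ k / (1 + S)\<^sup>2) (at S)"
  using steklov_integral_deriv_within[of S "S + 1" k] assms
  by (simp add: at_within_Icc_at)

lemma steklov_integral_continuous: "continuous_on {0..b} (steklov_integral k)"
  by (rule DERIV_continuous_on[OF steklov_integral_deriv_within]) auto

lemma steklov_integral_pos:
  assumes "0 < S"
  shows "0 < steklov_integral k S"
proof -
  have "steklov_integral k 0 < steklov_integral k S"
  proof (rule DERIV_pos_imp_increasing_open[OF assms])
    fix x :: real assume "0 < x" "x < S"
    then show "\<exists>y. (steklov_integral k has_real_derivative y) (at x) \<and> 0 < y"
      by (intro exI[of _ "x ^ k / (1 + x)\<^sup>2"] conjI steklov_integral_deriv) auto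
  qed (rule steklov_integral_continuous)
  then show ?thesis
    by simp
qed

section \<open>The half-angle substitution\<close>

lemma half_angle:
  assumes "0 < r" "r < pi"
  shows "tan (r / 2) > 0" "sin r = 2 * tan (r / 2) / (1 + (tan (r / 2))\<^sup>2)" "sin r > 0"
    "cos r = (1 - (tan (r / 2))\<^sup>2) / (1 + (tan (r / 2))\<^sup>2)" "cos (r / 2) > 0"
proof -
  show c: "cos (r / 2) > 0"
    using assms by (intro cos_gt_zero) auto
  show "tan (r / 2) > 0"
    using assms by (intro tan_gt_zero) auto
  show "sin r > 0"
    using assms by (intro sin_gt_zero)
  have "sin r = 2 * sin (r / 2) * cos (r / 2)"
    using sin_double[of "r / 2"] by simp
  moreover have sec: "1 + (tan (r / 2))\<^sup>2 = inverse ((cos (r / 2))\<^sup>2)"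
    using tan_sec[of "r / 2"] c by (simp add: power_inverse)
  ultimately show "sin r = 2 * tan (r / 2) / (1 + (tan (r / 2))\<^sup>2)"
    using c by (simp add: tan_def field_simps power2_eq_square)
  have "cos r = (cos (r / 2))\<^sup>2 - (sin (r / 2))\<^sup>2"
    using cos_double[of "r / 2"] by simp
  then show "cos r = (1 - (tan (r / 2))\<^sup>2) / (1 + (tan (r / 2))\<^sup>2)"
    using c unfolding sec by (simp add: tan_def power_divide left_diff_distrib divide_inverse[of _ "inverse _"])
qed

lemma tan_half_deriv:
  assumes "0 < r" "r < pi"
  shows "((\<lambda>r. tan (r / 2)) has_real_derivative tan (r / 2) / sin r) (at r)"
proof -
  note h = half_angle[OF assms]
  have "((\<lambda>r. tan (r / 2)) has_real_derivative inverse ((cos (r / 2))\<^sup>2) * (1 / 2)) (at r)"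
    by (rule DERIV_chain2[OF DERIV_tan]) (use h in \<open>auto intro!: derivative_eq_intros\<close>)
  also have "inverse ((cos (r / 2))\<^sup>2) * (1 / 2) = tan (r / 2) / sin r"
    using h sin_double[of "r / 2"] by (simp add: tan_def field_simps power2_eq_square)
  finally show ?thesis .
qed

text \<open>Thus \<open>tan\<^sup>k (r/2)\<close> lies in the kernel of
  \<open>sin r d/dr - k\<close>, and it is an integrating factor for the other factor
  \<open>sin r d/dr + k\<close> of the radial operator.\<close>

lemma tan_half_power_deriv:
  assumes "0 < r" "r < pi"
  shows "((\<lambda>r. tan (r / 2) ^ k) has_real_derivative real k * tan (r / 2) ^ k / sin r) (at r)"
proof -
  have "((\<lambda>r. tan (r / 2) ^ k) has_real_derivative
      real k * (tan (r / 2) / sin r * tan (r / 2) ^ (k - Suc 0))) (at r)"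
    by (rule DERIV_power[OF tan_half_deriv[OF assms], of k])
  also have "real k * (tan (r / 2) / sin r * tan (r / 2) ^ (k - Suc 0)) = real k * tan (r / 2) ^ k / sin r"
    \<comment> \<open>For \<open>k = 0\<close> the exponent \<open>k - Suc 0\<close> is truncated,
      but there the factor \<open>real k\<close> vanishes.\<close>
    by (cases k) auto
  finally show ?thesis .
qed

lemma tan_half_continuous:
  assumes "R < pi"
  shows "continuous_on {0..R} (\<lambda>r. tan (r / 2))"
proof -
  have "cos (r / 2) \<noteq> 0" if "r \<in> {0..R}" for r
    using that assms cos_gt_zero_pi[of "r / 2"] by auto
  then show ?thesis
    by (intro continuous_intros) auto
qed

section \<open>Regular solutions of the radial equations\<close>

context
  fixes k :: nat and R :: real
  assumes R: "0 < R" "R < pi"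
begin

text \<open>The operator factors: \<open>tan\<^sup>k (r/2)\<close> times \<open>sin\<^sup>2 U'' + sin cos U' - k\<^sup>2 U\<close> is
  \<open>sin r\<close> times the derivative of the function below.\<close>

lemma radial_first_integral:
  fixes U U' :: "real \<Rightarrow> real"
  assumes "\<And>r. r \<in> {0..R} \<Longrightarrow> (U has_real_derivative U' r) (at r within {0..R})"
    and "\<And>r. r \<in> {0..R} \<Longrightarrow> (U' has_real_derivative U'' r) (at r within {0..R})"
  defines "P \<equiv> \<lambda>r. tan (r / 2) ^ k * (sin r * U' r - real k * U r)"
  shows "continuous_on {0..R} P" "P 0 = 0"
    "\<And>r. 0 < r \<Longrightarrow> r < R \<Longrightarrow> (P has_real_derivative
      tan (r / 2) ^ k / sin r * ((sin r)\<^sup>2 * U'' r + sin r * cos r * U' r - (real k)\<^sup>2 * U r)) (at r)"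
proof -
  have "continuous_on {0..R} U" "continuous_on {0..R} U'"
    using assms(1,2) DERIV_continuous_on by blast+
  then show "continuous_on {0..R} P"
    unfolding P_def by (intro continuous_intros tan_half_continuous R)
  \<comment> \<open>Regularity at the center enters here: for \<open>k > 0\<close> the tangent power
    vanishes, for \<open>k = 0\<close> both \<open>sin 0\<close> and the factor
    \<open>real k\<close> do.\<close>
  show "P 0 = 0"
    by (cases k) (auto simp: P_def)
  fix r assume r: "0 < r" "r < R"
  then have at: "at r within {0..R} = at r"
    by (simp add: at_within_Icc_at)
  have dU: "(U has_real_derivative U' r) (at r)" "(U' has_real_derivative U'' r) (at r)"
    using assms(1,2)[of r] r by (simp_all add: at)
  have s: "sin r > 0"
    using half_angle r R by simp
  have "(P has_real_derivative
      real k * tan (r / 2) ^ k / sin r * (sin r * U' r - real k * U r)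
      + (cos r * U' r + U'' r * sin r - real k * U' r) * tan (r / 2) ^ k) (at r)"
    unfolding P_def
    by (intro DERIV_mult DERIV_diff DERIV_cmult DERIV_sin dU tan_half_power_deriv) (use r R in auto)
  also have "real k * tan (r / 2) ^ k / sin r * (sin r * U' r - real k * U r)
      + (cos r * U' r + U'' r * sin r - real k * U' r) * tan (r / 2) ^ k
      = tan (r / 2) ^ k / sin r * ((sin r)\<^sup>2 * U'' r + sin r * cos r * U' r - (real k)\<^sup>2 * U r)"
    using s by (simp add: field_simps power2_eq_square)
  finally show "(P has_real_derivative
      tan (r / 2) ^ k / sin r * ((sin r)\<^sup>2 * U'' r + sin r * cos r * U' r - (real k)\<^sup>2 * U r)) (at r)" .
qed

text \<open>The quotient \<open>W / tan\<^sup>k (r/2)\<close> has zero derivative. The center is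
  left out, since the denominator vanishes there for \<open>k > 0\<close>.\<close>

lemma first_order_radial:
  fixes W W' :: "real \<Rightarrow> real"
  assumes W: "\<And>r. r \<in> {0..R} \<Longrightarrow> (W has_real_derivative W' r) (at r within {0..R})"
    and eq: "\<And>r. 0 < r \<Longrightarrow> r \<le> R \<Longrightarrow> sin r * W' r = real k * W r"
  obtains C where "\<And>r. 0 < r \<Longrightarrow> r \<le> R \<Longrightarrow> W r = C * tan (r / 2) ^ k"
proof -
  let ?q = "\<lambda>r. W r / tan (r / 2) ^ k"
  have cW: "continuous_on {0..R} W"
    using W DERIV_continuous_on by blast
  have t: "tan (r / 2) > 0" if "0 < r" "r \<le> R" for r
    using half_angle that R by simp
  have "?q R = ?q r" if r: "0 < r" "r < R" for r
  proof (rule DERIV_isconst_end[OF r(2)])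
    have "tan (x / 2) ^ k \<noteq> 0" if "x \<in> {r..R}" for x
      using t[of x] that r by simp
    then show "continuous_on {r..R} ?q"
      using r by (intro continuous_intros continuous_on_subset[OF cW]
          continuous_on_subset[OF tan_half_continuous[OF R(2)]]) auto
    fix x assume x: "r < x" "x < R"
    then have x0: "0 < x" "x < pi"
      using r R by auto
    have "(W has_real_derivative W' x) (at x)"
      using W[of x] x r by (simp add: at_within_Icc_at)
    from DERIV_divide[OF this tan_half_power_deriv[OF x0, of k]] t[of x] x r
    have "(?q has_real_derivative (W' x * tan (x / 2) ^ k - W x * (real k * tan (x / 2) ^ k / sin x))
        / (tan (x / 2) ^ k * tan (x / 2) ^ k)) (at x)"
      by simp
    moreover have "W' x = real k * W x / sin x"
      using eq[of x] x r half_angle(3)[OF x0] by (simp add: field_simps)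
    ultimately show "(?q has_real_derivative 0) (at x)"
      by (simp add: field_simps)
  qed
  then have "W r = ?q R * tan (r / 2) ^ k" if "0 < r" "r \<le> R" for r
  proof (cases "r = R")
    case False
    then have "?q R = ?q r"
      using \<open>\<And>r. 0 < r \<Longrightarrow> r < R \<Longrightarrow> ?q R = ?q r\<close> that by simp
    then show ?thesis
      using t[OF that] by simp
  qed (use t[OF that] in simp)
  then show ?thesis
    by (rule that)
qed

text \<open>The first integral is constant and starts at zero, hence vanishes; this lowers the
  equation to first order and removes the singular solution.\<close>

lemma radial_harmonic:
  fixes W W' W'' :: "real \<Rightarrow> real"
  assumes W: "\<And>r. r \<in> {0..R} \<Longrightarrow> (W has_real_derivative W' r) (at r within {0..R})"
    and W': "\<And>r. r \<in> {0..R} \<Longrightarrow> (W' has_real_derivative W'' r) (at r within {0..R})"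
    and ode: "\<And>r. r \<in> {0..R} \<Longrightarrow> (sin r)\<^sup>2 * W'' r + sin r * cos r * W' r - (real k)\<^sup>2 * W r = 0"
  shows "\<And>r. 0 < r \<Longrightarrow> r \<le> R \<Longrightarrow> sin r * W' r = real k * W r"
proof -
  let ?P = "\<lambda>r. tan (r / 2) ^ k * (sin r * W' r - real k * W r)"
  have fi: "continuous_on {0..R} ?P" "?P 0 = 0"
    by (rule radial_first_integral[OF W W'], assumption+)+
  have d: "(?P has_real_derivative 0) (at r)" if "0 < r" "r < R" for r
  proof -
    have "(?P has_real_derivative tan (r / 2) ^ k / sin r *
        ((sin r)\<^sup>2 * W'' r + sin r * cos r * W' r - (real k)\<^sup>2 * W r)) (at r)"
      by (rule radial_first_integral(3)[OF W W' that])
    then show ?thesis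
      using ode[of r] that by simp
  qed
  fix r assume r: "0 < r" "r \<le> R"
  have "?P r = ?P 0"
    by (rule DERIV_isconst2[where f = ?P, OF R(1) fi(1) d]) (use r R in auto)
  then have "?P r = 0"
    using fi(2) by (simp only:)
  then show "sin r * W' r = real k * W r"
    using half_angle(1)[of r] r R by simp
qed

text \<open>The first integral of \<open>U\<close> has derivative
  \<open>C sin r tan(r/2)^(2k)\<close>. With \<open>S = tan\<^sup>2 (r/2)\<close>,
  \<open>dS = 2 S dr / sin r\<close> and \<open>sin\<^sup>2 r = 4 S / (1 + S)\<^sup>2\<close>, this
  becomes \<open>2 C S^k / (1 + S)\<^sup>2 dS\<close>, the origin of both the integral and the
  factor \<open>2\<close>.\<close>

lemma radial_biharmonic:
  fixes U U' U'' :: "real \<Rightarrow> real"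
  assumes U: "\<And>r. r \<in> {0..R} \<Longrightarrow> (U has_real_derivative U' r) (at r within {0..R})"
    and U': "\<And>r. r \<in> {0..R} \<Longrightarrow> (U' has_real_derivative U'' r) (at r within {0..R})"
    and ode: "\<And>r. 0 < r \<Longrightarrow> r < R \<Longrightarrow> (sin r)\<^sup>2 * U'' r + sin r * cos r * U' r - (real k)\<^sup>2 * U r
      = (sin r)\<^sup>2 * (C * tan (r / 2) ^ k)"
    and r: "0 \<le> r" "r \<le> R"
  shows "tan (r / 2) ^ k * (sin r * U' r - real k * U r) = 2 * C * steklov_integral k ((tan (r / 2))\<^sup>2)"
proof -
  let ?P = "\<lambda>r. tan (r / 2) ^ k * (sin r * U' r - real k * U r)"
  let ?J = "\<lambda>r. 2 * C * steklov_integral k ((tan (r / 2))\<^sup>2)"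
  have fi: "continuous_on {0..R} ?P" "?P 0 = 0"
    by (rule radial_first_integral[OF U U'], assumption+)+
  have "?P r - ?J r = ?P 0 - ?J 0"
  proof (rule DERIV_isconst2[where f = "\<lambda>r. ?P r - ?J r"])
    have "(\<lambda>r. (tan (r / 2))\<^sup>2) ` {0..R} \<subseteq> {0..(tan (R / 2))\<^sup>2}"
    proof -
      have "tan (s / 2) \<le> tan (R / 2)" "0 \<le> tan (s / 2)" if "s \<in> {0..R}" for s
        using that R by (auto intro!: tan_mono_le tan_pos_pi2_le)
      then show ?thesis
        by (auto intro!: power_mono)
    qed
    then have "continuous_on {0..R} (\<lambda>r. steklov_integral k ((tan (r / 2))\<^sup>2))"
      by (intro continuous_on_compose2[OF steklov_integral_continuous] continuous_intros
          tan_half_continuous R)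
    then show "continuous_on {0..R} (\<lambda>r. ?P r - ?J r)"
      by (intro continuous_on_diff fi(1) continuous_on_mult continuous_on_const)
    fix x assume x: "0 < x" "x < R"
    then have x0: "0 < x" "x < pi"
      using R by auto
    note h = half_angle[OF x0]
    let ?t = "tan (x / 2)"
    have dt: "((\<lambda>r. (tan (r / 2))\<^sup>2) has_real_derivative real 2 * ?t ^ 2 / sin x) (at x)"
      by (rule tan_half_power_deriv[OF x0])
    have "(?J has_real_derivative 2 * C * ((?t\<^sup>2) ^ k / (1 + ?t\<^sup>2)\<^sup>2 * (real 2 * ?t ^ 2 / sin x))) (at x)"
      using h(1) by (intro DERIV_cmult DERIV_chain2[OF steklov_integral_deriv dt]) auto
    moreover have "(?P has_real_derivative tan (x / 2) ^ k / sin x *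
        ((sin x)\<^sup>2 * U'' x + sin x * cos x * U' x - (real k)\<^sup>2 * U x)) (at x)"
      by (rule radial_first_integral(3)[OF U U' x])
    then have "(?P has_real_derivative ?t ^ k / sin x * ((sin x)\<^sup>2 * (C * ?t ^ k))) (at x)"
      using ode[OF x] by simp
    moreover have "?t ^ k / sin x * ((sin x)\<^sup>2 * (C * ?t ^ k))
        = 2 * C * ((?t\<^sup>2) ^ k / (1 + ?t\<^sup>2)\<^sup>2 * (real 2 * ?t ^ 2 / sin x))"
    proof -
      have q: "1 + ?t\<^sup>2 \<noteq> 0"
        by (smt (verit) zero_le_power2)
      have "sin x * sin x = 4 * ?t\<^sup>2 / (1 + ?t\<^sup>2)\<^sup>2"
        by (simp add: h(2) power2_eq_square)
      then have "?t ^ k / sin x * ((sin x)\<^sup>2 * (C * ?t ^ k))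
          = ?t ^ k * ?t ^ k * C / sin x * (4 * ?t\<^sup>2 / (1 + ?t\<^sup>2)\<^sup>2)"
        by (simp add: power2_eq_square)
      also have "?t ^ k * ?t ^ k = (?t\<^sup>2) ^ k"
        by (simp add: power2_eq_square power_mult_distrib)
      finally show ?thesis
        by (simp add: mult_ac)
    qed
    ultimately show "((\<lambda>r. ?P r - ?J r) has_real_derivative 0) (at x)"
      using DERIV_diff by fastforce
  qed (use r R in auto)
  also have "\<dots> = 0"
    using fi(2) by (simp only:) simp
  finally show ?thesis
    by simp
qed

text \<open>At \<open>R\<close> the condition \<open>U' R = 0\<close> turns the first integral into
  a relation between \<open>U R\<close> and \<open>C\<close>, and the harmonic part expresses
  \<open>W' R\<close>, hence \<open>\<xi> * U R\<close>, by \<open>C\<close>. Multiplying the two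
  relations leaves \<open>C * U R\<close> on both sides, which cancels.\<close>

lemma radial_steklov:
  fixes U U' U'' W W' W'' :: "real \<Rightarrow> real"
  assumes U: "\<And>r. r \<in> {0..R} \<Longrightarrow> (U has_real_derivative U' r) (at r within {0..R})"
    and U': "\<And>r. r \<in> {0..R} \<Longrightarrow> (U' has_real_derivative U'' r) (at r within {0..R})"
    and W: "\<And>r. r \<in> {0..R} \<Longrightarrow> (W has_real_derivative W' r) (at r within {0..R})"
    and W': "\<And>r. r \<in> {0..R} \<Longrightarrow> (W' has_real_derivative W'' r) (at r within {0..R})"
    and odeU: "\<And>r. r \<in> {0..R} \<Longrightarrow>
      (sin r)\<^sup>2 * U'' r + sin r * cos r * U' r - (real k)\<^sup>2 * U r = (sin r)\<^sup>2 * W r"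
    and odeW: "\<And>r. r \<in> {0..R} \<Longrightarrow> (sin r)\<^sup>2 * W'' r + sin r * cos r * W' r - (real k)\<^sup>2 * W r = 0"
    and bc: "U' R = 0" "W' R + \<xi> * U R = 0"
    and ne: "0 < r0" "r0 \<le> R" "U r0 \<noteq> 0"
  shows "\<xi> = steklov_xi k R"
proof -
  let ?T = "tan (R / 2)" and ?I = "steklov_integral k ((tan (R / 2))\<^sup>2)"
  note h = half_angle[OF R]
  have I: "?I > 0"
    using h(1) by (intro steklov_integral_pos) simp
  have eqW: "sin r * W' r = real k * W r" if "0 < r" "r \<le> R" for r
    using radial_harmonic[OF W W' odeW] that by blast
  obtain C where C: "\<And>r. 0 < r \<Longrightarrow> r \<le> R \<Longrightarrow> W r = C * tan (r / 2) ^ k"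
    using first_order_radial[OF W eqW] by blast
  have PU: "tan (r / 2) ^ k * (sin r * U' r - real k * U r) = 2 * C * steklov_integral k ((tan (r / 2))\<^sup>2)"
    if "0 \<le> r" "r \<le> R" for r
    by (rule radial_biharmonic[OF U U' _ that]) (use odeU C in auto)
  have PR: "- (?T ^ k * real k * U R) = 2 * C * ?I"
    using PU[of R] R bc by simp
  have WR: "sin R * W' R = real k * (C * ?T ^ k)"
    using eqW[of R] C[of R] R by simp
  then have xiU: "sin R * (\<xi> * U R) = - (real k * (C * ?T ^ k))"
    using bc(2) by (metis add_eq_0_iff minus_mult_right minus_minus)
  show ?thesis
  proof (cases "C = 0")
    case False
    then have "2 * C * ?I \<noteq> 0"
      using I by simp
    then have "?T ^ k * real k * U R \<noteq> 0"
      using PR by linarith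
    then have UR: "U R \<noteq> 0"
      by auto
    have "\<xi> * (2 * sin R * ?I) * (C * U R) = sin R * (\<xi> * U R) * (2 * C * ?I)"
      by simp
    also have "\<dots> = (real k * (C * ?T ^ k)) * (?T ^ k * real k * U R)"
      unfolding xiU PR[symmetric] by simp
    also have "\<dots> = (real k)\<^sup>2 * (?T\<^sup>2) ^ k * (C * U R)"
      by (simp add: power2_eq_square power_mult_distrib)
    finally have "\<xi> * (2 * sin R * ?I) = (real k)\<^sup>2 * (?T\<^sup>2) ^ k"
      using False UR by simp
    then show ?thesis
      using I h(3) by (simp add: steklov_xi_def field_simps)
  next
    \<comment> \<open>Now \<open>U\<close> itself is harmonic, and a nonzero multiple of
      \<open>tan\<^sup>k (r/2)\<close> meets the Neumann condition only for \<open>k = 0\<close>,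
      where \<open>\<xi>\<close> and \<open>steklov_xi 0 R\<close> are both zero.\<close>
    case True
    have "sin r * U' r = real k * U r" if "0 < r" "r \<le> R" for r
      using PU[of r] that True half_angle(1)[of r] R by simp
    from first_order_radial[OF U this] obtain D where
      D: "\<And>r. 0 < r \<Longrightarrow> r \<le> R \<Longrightarrow> U r = D * tan (r / 2) ^ k"
      by blast
    have "D \<noteq> 0"
      using ne D by auto
    then have UR: "U R \<noteq> 0"
      using D[of R] R h(1) by simp
    then have "k = 0"
      using PR True h(1) by simp
    moreover have "\<xi> = 0"
      using xiU True UR h(3) by simp
    ultimately show ?thesis
      by (simp add: steklov_xi_def)
  qed
qed

end

section \<open>Angular modes\<close>

text \<open>The direction \<open>V a\<close> varies with the parameter; expanding it in
  \<open>Basis\<close> reduces the claim to derivatives in fixed directions.\<close>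

lemma continuous_on_hess:
  assumes "open S" "smooth_on S u" "continuous_on A X" "continuous_on A V" "X ` A \<subseteq> S"
  shows "continuous_on A (\<lambda>a. hess u (X a) (V a))"
proof -
  have g: "smooth_on S (grad u)"
    using smooth_on_grad assms by blast
  have "hess u (X a) (V a)
      = (\<Sum>b\<in>Basis. (V a \<bullet> b) *\<^sub>R frechet_derivative (grad u) (at (X a)) b) \<bullet> V a" if "a \<in> A" for a
  proof -
    have "grad u differentiable (at (X a))"
      using smooth_on_has_derivative[OF g, of "X a"] that assms(5) differentiable_def by blast
    from frechet_derivative_Basis_sum[OF this, of "V a"] show ?thesis
      by (simp add: hess_def)
  qed
  moreover have "continuous_on A (\<lambda>a. frechet_derivative (grad u) (at (X a)) b)" for b
    using continuous_on_compose2[OF smooth_on_imp_continuous_on[OF smooth_on_frechet_derivative[OF g]]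
        assms(3,5)] .
  then have "continuous_on A
      (\<lambda>a. (\<Sum>b\<in>Basis. (V a \<bullet> b) *\<^sub>R frechet_derivative (grad u) (at (X a)) b) \<bullet> V a)"
    by (intro continuous_intros assms)
  ultimately show ?thesis
    using continuous_on_cong by force
qed

context sphere_frame
begin

text \<open>The weight \<open>\<phi>\<close> stands for \<open>cos (k t)\<close> or
  \<open>sin (k t)\<close>. The analysis uses only its differential equation and its periodicity, so
  both kinds of Fourier coefficient are treated at once.\<close>

definition mode :: "(real \<Rightarrow> real) \<Rightarrow> (real^3 \<Rightarrow> real) \<Rightarrow> real \<Rightarrow> real" where
  "mode \<phi> u r = integral {0..2 * pi} (\<lambda>t. u (polar r t) * \<phi> t)"

definition mode_r :: "(real \<Rightarrow> real) \<Rightarrow> (real^3 \<Rightarrow> real) \<Rightarrow> real \<Rightarrow> real" where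
  "mode_r \<phi> u r = integral {0..2 * pi} (\<lambda>t. (grad u (polar r t) \<bullet> polar_r r t) * \<phi> t)"

definition mode_rr :: "(real \<Rightarrow> real) \<Rightarrow> (real^3 \<Rightarrow> real) \<Rightarrow> real \<Rightarrow> real" where
  "mode_rr \<phi> u r = integral {0..2 * pi}
     (\<lambda>t. (hess u (polar r t) (polar_r r t) - grad u (polar r t) \<bullet> polar r t) * \<phi> t)"

lemma dir_periodic [simp]: "dir (2 * pi) = dir 0" "dir' (2 * pi) = dir' 0"
  by (simp_all add: dir_def dir'_def)

lemma polar_periodic [simp]: "polar r (2 * pi) = polar r 0"
  by (simp add: polar_def)

context
  fixes S :: "(real^3) set" and u :: "real^3 \<Rightarrow> real" and R :: real
    and k :: nat and \<phi> \<phi>' :: "real \<Rightarrow> real"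
  assumes S: "open S" and u: "smooth_on S u"
    and R: "0 < R" "R < pi" and disk: "geodesic_disk p R \<subseteq> S"
    and phi: "\<And>t. (\<phi> has_real_derivative \<phi>' t) (at t)"
      "\<And>t. (\<phi>' has_real_derivative - (real k)\<^sup>2 * \<phi> t) (at t)"
      "\<phi> (2 * pi) = \<phi> 0" "\<phi>' (2 * pi) = \<phi>' 0"
begin

lemma polar_S: "0 \<le> r \<Longrightarrow> r \<le> R \<Longrightarrow> polar r t \<in> S"
  using polar_in_disk[of r R t] R disk by auto

lemma phi_continuous: "continuous_on A \<phi>"
  using phi(1) by (meson DERIV_isCont continuous_at_imp_continuous_on)

lemma grad_continuous: "continuous_on S (grad u)"
  using smooth_on_imp_continuous_on[OF smooth_on_grad[OF S u]] .

lemma polar_image: "fst ` A \<subseteq> {0..R} \<Longrightarrow> (\<lambda>x. polar (fst x) (snd x)) ` A \<subseteq> S"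
  using polar_S by fastforce

text \<open>Joint continuity over a free set \<open>A\<close> serves twice: on slices it gives
  integrability, on a rectangle it allows differentiation under the integral sign.\<close>

lemma integrands_continuous:
  fixes A :: "(real \<times> real) set"
  assumes "fst ` A \<subseteq> {0..R}"
  shows "continuous_on A (\<lambda>x. u (polar (fst x) (snd x)) * \<phi> (snd x))"
    "continuous_on A (\<lambda>x. (grad u (polar (fst x) (snd x)) \<bullet> polar_r (fst x) (snd x)) * \<phi> (snd x))"
    "continuous_on A (\<lambda>x. (hess u (polar (fst x) (snd x)) (polar_r (fst x) (snd x))
       - grad u (polar (fst x) (snd x)) \<bullet> polar (fst x) (snd x)) * \<phi> (snd x))"
proof -
  have phi2: "continuous_on A (\<lambda>x. \<phi> (snd x))"
    by (rule continuous_on_compose2[OF phi_continuous[of UNIV]]) (auto intro: continuous_intros)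
  have X: "continuous_on A (\<lambda>x. polar (fst x) (snd x))" "continuous_on A (\<lambda>x. polar_r (fst x) (snd x))"
    by (intro continuous_intros)+
  have g: "continuous_on A (\<lambda>x. grad u (polar (fst x) (snd x)))"
    by (rule continuous_on_compose2[OF grad_continuous X(1) polar_image[OF assms]])
  have u': "continuous_on A (\<lambda>x. u (polar (fst x) (snd x)))"
    by (rule continuous_on_compose2[OF smooth_on_imp_continuous_on[OF u] X(1) polar_image[OF assms]])
  show "continuous_on A (\<lambda>x. u (polar (fst x) (snd x)) * \<phi> (snd x))"
    by (intro continuous_on_mult u' phi2)
  show "continuous_on A (\<lambda>x. (grad u (polar (fst x) (snd x)) \<bullet> polar_r (fst x) (snd x)) * \<phi> (snd x))"
    by (intro continuous_on_mult continuous_on_inner g X phi2)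
  show "continuous_on A (\<lambda>x. (hess u (polar (fst x) (snd x)) (polar_r (fst x) (snd x))
       - grad u (polar (fst x) (snd x)) \<bullet> polar (fst x) (snd x)) * \<phi> (snd x))"
    by (intro continuous_on_mult continuous_on_diff continuous_on_hess[OF S u] continuous_on_inner
        g X phi2 polar_image assms)
qed

lemma integrable_slice:
  fixes f :: "real \<times> real \<Rightarrow> real"
  assumes "continuous_on ({r} \<times> UNIV) f"
  shows "(\<lambda>t. f (r, t)) integrable_on {0..2 * pi}"
  by (intro integrable_continuous_real continuous_on_compose2[OF assms]) (auto intro: continuous_intros)

lemma integrands_integrable:
  assumes "0 \<le> r" "r \<le> R"
  shows "(\<lambda>t. u (polar r t) * \<phi> t) integrable_on {0..2 * pi}"
    "(\<lambda>t. (grad u (polar r t) \<bullet> polar_r r t) * \<phi> t) integrable_on {0..2 * pi}"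
    "(\<lambda>t. (hess u (polar r t) (polar_r r t) - grad u (polar r t) \<bullet> polar r t) * \<phi> t)
       integrable_on {0..2 * pi}"
proof -
  have A: "fst ` ({r} \<times> (UNIV :: real set)) \<subseteq> {0..R}"
    using assms by auto
  show "(\<lambda>t. u (polar r t) * \<phi> t) integrable_on {0..2 * pi}"
    "(\<lambda>t. (grad u (polar r t) \<bullet> polar_r r t) * \<phi> t) integrable_on {0..2 * pi}"
    "(\<lambda>t. (hess u (polar r t) (polar_r r t) - grad u (polar r t) \<bullet> polar r t) * \<phi> t)
       integrable_on {0..2 * pi}"
    using integrands_continuous[OF A, THEN integrable_slice] by simp_all
qed

lemma mode_deriv:
  assumes "r \<in> {0..R}"
  shows "(mode \<phi> u has_real_derivative mode_r \<phi> u r) (at r within {0..R})"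
  unfolding mode_def[abs_def] mode_r_def cbox_interval[of 0 "2 * pi", symmetric]
proof (rule leibniz_rule_field_derivative[where U = "{0..R}"])
  fix x t assume x: "x \<in> {0..R}"
  show "((\<lambda>r. u (polar r t) * \<phi> t) has_real_derivative (grad u (polar x t) \<bullet> polar_r x t) * \<phi> t)
      (at x within {0..R})"
    using x by (intro DERIV_cmult_right deriv_r[OF S u] polar_S) auto
  show "(\<lambda>t. u (polar x t) * \<phi> t) integrable_on cbox 0 (2 * pi)"
    using integrands_integrable[of x] x by simp
next
  show "continuous_on ({0..R} \<times> cbox 0 (2 * pi)) (\<lambda>(x, t). (grad u (polar x t) \<bullet> polar_r x t) * \<phi> t)"
    using integrands_continuous(2)[of "{0..R} \<times> cbox 0 (2 * pi)"] by (simp add: case_prod_unfold)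
qed (use assms in auto)

lemma mode_r_deriv:
  assumes "r \<in> {0..R}"
  shows "(mode_r \<phi> u has_real_derivative mode_rr \<phi> u r) (at r within {0..R})"
  unfolding mode_rr_def mode_r_def[abs_def] cbox_interval[of 0 "2 * pi", symmetric]
proof (rule leibniz_rule_field_derivative[where U = "{0..R}"])
  fix x t assume x: "x \<in> {0..R}"
  show "((\<lambda>r. (grad u (polar r t) \<bullet> polar_r r t) * \<phi> t) has_real_derivative
      (hess u (polar x t) (polar_r x t) - grad u (polar x t) \<bullet> polar x t) * \<phi> t) (at x within {0..R})"
    using x by (intro DERIV_cmult_right deriv_rr[OF S u] polar_S) auto
  show "(\<lambda>t. (grad u (polar x t) \<bullet> polar_r x t) * \<phi> t) integrable_on cbox 0 (2 * pi)"
    using integrands_integrable[of x] x by simp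
next
  show "continuous_on ({0..R} \<times> cbox 0 (2 * pi))
      (\<lambda>(x, t). (hess u (polar x t) (polar_r x t) - grad u (polar x t) \<bullet> polar x t) * \<phi> t)"
    using integrands_continuous(3)[of "{0..R} \<times> cbox 0 (2 * pi)"] by (simp add: case_prod_unfold)
qed (use assms in auto)

text \<open>Two integrations by parts in the angle; the boundary terms cancel by periodicity.\<close>

lemma mode_tt:
  assumes r: "0 \<le> r" "r \<le> R"
  shows "((\<lambda>t. (sin r * (sin r * hess u (polar r t) (dir' t) - grad u (polar r t) \<bullet> dir t)) * \<phi> t)
    has_integral - (real k)\<^sup>2 * mode \<phi> u r) {0..2 * pi}"
proof -
  let ?F = "\<lambda>t. u (polar r t)" and ?F1 = "\<lambda>t. sin r * (grad u (polar r t) \<bullet> dir' t)"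
  let ?F2 = "\<lambda>t. sin r * (sin r * hess u (polar r t) (dir' t) - grad u (polar r t) \<bullet> dir t)"
  have d: "((\<lambda>t. ?F1 t * \<phi> t - ?F t * \<phi>' t) has_real_derivative
      (?F2 t * \<phi> t + \<phi>' t * ?F1 t) - (?F1 t * \<phi>' t + (- (real k)\<^sup>2 * \<phi> t) * ?F t)) (at t within {0..2 * pi})" for t
    by (intro DERIV_diff DERIV_mult deriv_t[OF S u] deriv_tt[OF S u] polar_S r
        phi(1)[THEN has_field_derivative_at_within] phi(2)[THEN has_field_derivative_at_within])
  have "((\<lambda>t. (?F2 t * \<phi> t + \<phi>' t * ?F1 t) - (?F1 t * \<phi>' t + (- (real k)\<^sup>2 * \<phi> t) * ?F t)) has_integral
      (?F1 (2 * pi) * \<phi> (2 * pi) - ?F (2 * pi) * \<phi>' (2 * pi)) - (?F1 0 * \<phi> 0 - ?F 0 * \<phi>' 0)) {0..2 * pi}"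
    by (rule fundamental_theorem_of_calculus)
      (use d in \<open>auto simp: has_real_derivative_iff_has_vector_derivative\<close>)
  moreover have "(?F1 (2 * pi) * \<phi> (2 * pi) - ?F (2 * pi) * \<phi>' (2 * pi)) - (?F1 0 * \<phi> 0 - ?F 0 * \<phi>' 0) = 0"
    by (simp add: phi(3,4))
  moreover have "(?F2 t * \<phi> t + \<phi>' t * ?F1 t) - (?F1 t * \<phi>' t + (- (real k)\<^sup>2 * \<phi> t) * ?F t)
      = ?F2 t * \<phi> t + (real k)\<^sup>2 * (?F t * \<phi> t)" for t
    by (simp add: algebra_simps)
  ultimately have "((\<lambda>t. ?F2 t * \<phi> t + (real k)\<^sup>2 * (?F t * \<phi> t)) has_integral 0) {0..2 * pi}"
    by (simp only:)
  moreover have "((\<lambda>t. (real k)\<^sup>2 * (?F t * \<phi> t)) has_integral (real k)\<^sup>2 * mode \<phi> u r) {0..2 * pi}"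
    unfolding mode_def by (intro has_integral_mult_right integrable_integral integrands_integrable r)
  ultimately have "((\<lambda>t. ?F2 t * \<phi> t + (real k)\<^sup>2 * (?F t * \<phi> t) - (real k)\<^sup>2 * (?F t * \<phi> t))
      has_integral 0 - (real k)\<^sup>2 * mode \<phi> u r) {0..2 * pi}"
    by (rule has_integral_diff)
  then show ?thesis
    by simp
qed

text \<open>This is \<open>laplacian_polar\<close> integrated against \<open>\<phi>\<close>; by
  \<open>mode_tt\<close> the angular term turns into \<open>- k\<^sup>2\<close> times the
  coefficient.\<close>

lemma mode_laplacian:
  assumes r: "0 \<le> r" "r \<le> R"
  shows "(sin r)\<^sup>2 * mode_rr \<phi> u r + sin r * cos r * mode_r \<phi> u r - (real k)\<^sup>2 * mode \<phi> u r
    = (sin r)\<^sup>2 * mode \<phi> (sphere_laplacian u) r"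
proof -
  have "((\<lambda>t. (sin r)\<^sup>2 * ((hess u (polar r t) (polar_r r t) - grad u (polar r t) \<bullet> polar r t) * \<phi> t)
      + (sin r * cos r) * ((grad u (polar r t) \<bullet> polar_r r t) * \<phi> t)
      + (sin r * (sin r * hess u (polar r t) (dir' t) - grad u (polar r t) \<bullet> dir t)) * \<phi> t)
    has_integral (sin r)\<^sup>2 * mode_rr \<phi> u r + (sin r * cos r) * mode_r \<phi> u r + - (real k)\<^sup>2 * mode \<phi> u r)
    {0..2 * pi}"
    unfolding mode_r_def mode_rr_def
    by (intro has_integral_add mode_tt has_integral_mult_right integrable_integral integrands_integrable r)
  moreover have "(sin r)\<^sup>2 * ((hess u (polar r t) (polar_r r t) - grad u (polar r t) \<bullet> polar r t) * \<phi> t)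
      + (sin r * cos r) * ((grad u (polar r t) \<bullet> polar_r r t) * \<phi> t)
      + (sin r * (sin r * hess u (polar r t) (dir' t) - grad u (polar r t) \<bullet> dir t)) * \<phi> t
      = (sin r)\<^sup>2 * (sphere_laplacian u (polar r t) * \<phi> t)" for t
    unfolding mult.assoc[symmetric] laplacian_polar[OF S u polar_S[OF r], symmetric]
    by (simp only: distrib_right)
  ultimately have "((\<lambda>t. (sin r)\<^sup>2 * (sphere_laplacian u (polar r t) * \<phi> t))
    has_integral (sin r)\<^sup>2 * mode_rr \<phi> u r + (sin r * cos r) * mode_r \<phi> u r + - (real k)\<^sup>2 * mode \<phi> u r)
    {0..2 * pi}"
    by simp
  then have "integral {0..2 * pi} (\<lambda>t. (sin r)\<^sup>2 * (sphere_laplacian u (polar r t) * \<phi> t))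
      = (sin r)\<^sup>2 * mode_rr \<phi> u r + (sin r * cos r) * mode_r \<phi> u r + - (real k)\<^sup>2 * mode \<phi> u r"
    by (rule integral_unique)
  then show ?thesis
    by (simp add: mode_def)
qed

end

text \<open>A single nonvanishing Fourier coefficient already determines \<open>\<xi>\<close>. This
  serves both to exclude further eigenvalues and to identify the eigenvalue of the explicit
  eigenfunctions.\<close>

lemma steklov_mode:
  fixes u :: "real^3 \<Rightarrow> real"
  assumes S: "open S" "geodesic_disk p R \<subseteq> S" "smooth_on S u" and R: "0 < R" "R < pi"
    and biharm: "\<And>x. x \<in> geodesic_disk p R \<Longrightarrow> sphere_laplacian (sphere_laplacian u) x = 0"
    and bc1: "\<And>x. x \<in> geodesic_circle p R \<Longrightarrow> normal_deriv p R u x = 0"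
    and bc2: "\<And>x. x \<in> geodesic_circle p R \<Longrightarrow> normal_deriv p R (sphere_laplacian u) x + \<xi> * u x = 0"
    and phi: "\<And>t. (\<phi> has_real_derivative \<phi>' t) (at t)"
      "\<And>t. (\<phi>' has_real_derivative - (real k)\<^sup>2 * \<phi> t) (at t)"
      "\<phi> (2 * pi) = \<phi> 0" "\<phi>' (2 * pi) = \<phi>' 0"
    and r: "0 < r" "r \<le> R" and ne: "mode \<phi> u r \<noteq> 0"
  shows "\<xi> = steklov_xi k R"
proof -
  let ?L = "sphere_laplacian u"
  have L: "smooth_on S ?L"
    using smooth_on_sphere_laplacian S by blast
  have sR: "sin R \<noteq> 0"
    using half_angle(3)[OF R] by simp
  show ?thesis
  proof (rule radial_steklov[OF R, where U = "mode \<phi> u" and U' = "mode_r \<phi> u" and U'' = "mode_rr \<phi> u"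
        and W = "mode \<phi> ?L" and W' = "mode_r \<phi> ?L" and W'' = "mode_rr \<phi> ?L"])
    fix r assume r: "r \<in> {0..R}"
    show "(mode \<phi> u has_real_derivative mode_r \<phi> u r) (at r within {0..R})"
      by (rule mode_deriv[OF S(1,3) R S(2) phi r])
    show "(mode_r \<phi> u has_real_derivative mode_rr \<phi> u r) (at r within {0..R})"
      by (rule mode_r_deriv[OF S(1,3) R S(2) phi r])
    show "(mode \<phi> ?L has_real_derivative mode_r \<phi> ?L r) (at r within {0..R})"
      by (rule mode_deriv[OF S(1) L R S(2) phi r])
    show "(mode_r \<phi> ?L has_real_derivative mode_rr \<phi> ?L r) (at r within {0..R})"
      by (rule mode_r_deriv[OF S(1) L R S(2) phi r])
    have r': "0 \<le> r" "r \<le> R"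
      using r by auto
    show "(sin r)\<^sup>2 * mode_rr \<phi> u r + sin r * cos r * mode_r \<phi> u r - (real k)\<^sup>2 * mode \<phi> u r
        = (sin r)\<^sup>2 * mode \<phi> ?L r"
      by (rule mode_laplacian[OF S(1,3) R S(2) phi r'])
    have "mode \<phi> (sphere_laplacian ?L) r = 0"
      using biharm polar_in_disk[OF r' R(2)] by (simp add: mode_def)
    then show "(sin r)\<^sup>2 * mode_rr \<phi> ?L r + sin r * cos r * mode_r \<phi> ?L r - (real k)\<^sup>2 * mode \<phi> ?L r = 0"
      using mode_laplacian[OF S(1) L R S(2) phi r'] by simp
  next
    have c: "polar R t \<in> geodesic_circle p R" for t
      using polar_in_circle R by simp
    show "mode_r \<phi> u R = 0"
      using bc1[OF c] by (simp add: mode_r_def normal_deriv_polar[OF sR])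
    have "(grad ?L (polar R t) \<bullet> polar_r R t) = - (\<xi> * u (polar R t))" for t
      using bc2[OF c, of t] by (simp add: normal_deriv_polar[OF sR])
    then show "mode_r \<phi> ?L R + \<xi> * mode \<phi> u R = 0"
      by (simp add: mode_r_def mode_def mult.assoc)
  qed (use r ne in auto)
qed

end

section \<open>Completeness of the trigonometric system\<close>

text \<open>Orthogonality to all trigonometric functions, encoded so as to be stable under
  multiplication by \<open>cos t\<close> and \<open>sin t\<close>. These shift the frequency by one
  in both directions, hence \<open>j\<close> ranges over the integers.\<close>

definition fourier_null :: "(real \<Rightarrow> real) \<Rightarrow> bool" where
  "fourier_null h \<longleftrightarrow> continuous_on {0..2 * pi} h \<and>
    (\<forall>j::int. ((\<lambda>t. h t * cos (of_int j * t)) has_integral 0) {0..2 * pi} \<and>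
      ((\<lambda>t. h t * sin (of_int j * t)) has_integral 0) {0..2 * pi})"

lemma fourier_null_cmult:
  assumes "fourier_null h"
  shows "fourier_null (\<lambda>t. c * h t)"
  unfolding fourier_null_def
proof (intro conjI allI)
  show "continuous_on {0..2 * pi} (\<lambda>t. c * h t)"
    using assms by (auto simp: fourier_null_def intro!: continuous_intros)
  fix j :: int
  have "((\<lambda>t. c * (h t * cos (of_int j * t))) has_integral c * 0) {0..2 * pi}"
    "((\<lambda>t. c * (h t * sin (of_int j * t))) has_integral c * 0) {0..2 * pi}"
    using assms unfolding fourier_null_def by (intro has_integral_mult_right; blast)+
  then show "((\<lambda>t. c * h t * cos (of_int j * t)) has_integral 0) {0..2 * pi}"
    "((\<lambda>t. c * h t * sin (of_int j * t)) has_integral 0) {0..2 * pi}"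
    by (simp_all add: mult.assoc)
qed

lemma fourier_null_add:
  assumes "fourier_null h" "fourier_null h'"
  shows "fourier_null (\<lambda>t. h t + h' t)"
  unfolding fourier_null_def
proof (intro conjI allI)
  show "continuous_on {0..2 * pi} (\<lambda>t. h t + h' t)"
    using assms by (auto simp: fourier_null_def intro!: continuous_intros)
  fix j :: int
  have "((\<lambda>t. h t * cos (of_int j * t) + h' t * cos (of_int j * t)) has_integral 0 + 0) {0..2 * pi}"
    "((\<lambda>t. h t * sin (of_int j * t) + h' t * sin (of_int j * t)) has_integral 0 + 0) {0..2 * pi}"
    using assms unfolding fourier_null_def by (intro has_integral_add; blast)+
  then show "((\<lambda>t. (h t + h' t) * cos (of_int j * t)) has_integral 0) {0..2 * pi}"
    "((\<lambda>t. (h t + h' t) * sin (of_int j * t)) has_integral 0) {0..2 * pi}"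
    by (simp_all add: distrib_right)
qed

lemma fourier_null_cos:
  assumes "fourier_null h"
  shows "fourier_null (\<lambda>t. cos t * h t)"
  unfolding fourier_null_def
proof (intro conjI allI)
  show "continuous_on {0..2 * pi} (\<lambda>t. cos t * h t)"
    using assms by (auto simp: fourier_null_def intro!: continuous_intros)
  fix j :: int
  have I: "((\<lambda>t. 1 / 2 * (h t * cos (of_int (j + 1) * t) + h t * cos (of_int (j - 1) * t)))
      has_integral 1 / 2 * (0 + 0)) {0..2 * pi}"
    "((\<lambda>t. 1 / 2 * (h t * sin (of_int (j + 1) * t) + h t * sin (of_int (j - 1) * t)))
      has_integral 1 / 2 * (0 + 0)) {0..2 * pi}"
    using assms unfolding fourier_null_def
    by (intro has_integral_mult_right has_integral_add; blast)+
  have "cos (of_int (j + 1) * t) + cos (of_int (j - 1) * t) = 2 * (cos t * cos (of_int j * t))"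
    "sin (of_int (j + 1) * t) + sin (of_int (j - 1) * t) = 2 * (cos t * sin (of_int j * t))" for t :: real
    by (simp_all add: distrib_right left_diff_distrib cos_add cos_diff sin_add sin_diff)
  then have "1 / 2 * (h t * cos (of_int (j + 1) * t) + h t * cos (of_int (j - 1) * t))
      = cos t * h t * cos (of_int j * t)"
    "1 / 2 * (h t * sin (of_int (j + 1) * t) + h t * sin (of_int (j - 1) * t))
      = cos t * h t * sin (of_int j * t)" for t
    by (simp_all only: distrib_left[symmetric]) simp_all
  with I show "((\<lambda>t. cos t * h t * cos (of_int j * t)) has_integral 0) {0..2 * pi}"
    "((\<lambda>t. cos t * h t * sin (of_int j * t)) has_integral 0) {0..2 * pi}"
    by (simp_all only: add_0 mult_zero_right)
qed

lemma fourier_null_sin: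
  assumes "fourier_null h"
  shows "fourier_null (\<lambda>t. sin t * h t)"
  unfolding fourier_null_def
proof (intro conjI allI)
  show "continuous_on {0..2 * pi} (\<lambda>t. sin t * h t)"
    using assms by (auto simp: fourier_null_def intro!: continuous_intros)
  fix j :: int
  have I: "((\<lambda>t. 1 / 2 * (h t * sin (of_int (j + 1) * t) - h t * sin (of_int (j - 1) * t)))
      has_integral 1 / 2 * (0 - 0)) {0..2 * pi}"
    "((\<lambda>t. 1 / 2 * (h t * cos (of_int (j - 1) * t) - h t * cos (of_int (j + 1) * t)))
      has_integral 1 / 2 * (0 - 0)) {0..2 * pi}"
    using assms unfolding fourier_null_def
    by (intro has_integral_mult_right has_integral_diff; blast)+
  have "sin (of_int (j + 1) * t) - sin (of_int (j - 1) * t) = 2 * (sin t * cos (of_int j * t))"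
    "cos (of_int (j - 1) * t) - cos (of_int (j + 1) * t) = 2 * (sin t * sin (of_int j * t))" for t :: real
    by (simp_all add: distrib_right left_diff_distrib cos_add cos_diff sin_add sin_diff)
  then have "1 / 2 * (h t * sin (of_int (j + 1) * t) - h t * sin (of_int (j - 1) * t))
      = sin t * h t * cos (of_int j * t)"
    "1 / 2 * (h t * cos (of_int (j - 1) * t) - h t * cos (of_int (j + 1) * t))
      = sin t * h t * sin (of_int j * t)" for t
    by (simp_all only: right_diff_distrib[symmetric]) simp_all
  with I show "((\<lambda>t. sin t * h t * cos (of_int j * t)) has_integral 0) {0..2 * pi}"
    "((\<lambda>t. sin t * h t * sin (of_int j * t)) has_integral 0) {0..2 * pi}"
    by (simp_all only: diff_0_right mult_zero_right)
qed

text \<open>The function \<open>h\<close> is generalized because a product \<open>f g\<close> is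
  treated by applying the hypothesis for \<open>f\<close> to \<open>g h\<close>.\<close>

lemma fourier_null_polynomial:
  assumes "real_polynomial_function q" "fourier_null h"
  shows "fourier_null (\<lambda>t. q (cis t) * h t)"
  using assms
proof (induction q arbitrary: h)
  case (linear f)
  have lin: "linear f"
    using linear.hyps bounded_linear.linear by blast
  have "f (cis t) = f 1 * cos t + f \<i> * sin t" for t
  proof -
    have "cis t = cos t *\<^sub>R 1 + sin t *\<^sub>R \<i>"
      by (simp add: complex_eq_iff)
    then show ?thesis
      by (simp add: linear_add[OF lin] linear_scale[OF lin])
  qed
  then have "(\<lambda>t. f (cis t) * h t) = (\<lambda>t. f 1 * (cos t * h t) + f \<i> * (sin t * h t))"
    by (auto simp: algebra_simps)
  then show ?case
    using linear.prems by (simp add: fourier_null_add fourier_null_cmult fourier_null_cos fourier_null_sin)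
next
  case (const c)
  then show ?case
    by (rule fourier_null_cmult)
next
  case (add f g)
  then show ?case
    by (simp add: distrib_right fourier_null_add)
next
  case (mult f g)
  then show ?case
    by (simp add: mult.assoc)
qed

text \<open>Placing \<open>H\<close> on the unit circle of the complex plane builds in periodicity
  and makes Stone-Weierstrass applicable: \<open>H\<close> is uniformly close to polynomials in
  \<open>cis t\<close>, to all of which it is orthogonal, so its square integral is zero.\<close>

lemma fourier_complete:
  fixes H :: "complex \<Rightarrow> real"
  assumes H: "continuous_on (sphere 0 1) H"
    and c: "\<And>k::nat. integral {0..2 * pi} (\<lambda>t. H (cis t) * cos (real k * t)) = 0"
    and s: "\<And>k::nat. integral {0..2 * pi} (\<lambda>t. H (cis t) * sin (real k * t)) = 0"
    and t: "t \<in> {0..2 * pi}"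
  shows "H (cis t) = 0"
proof -
  let ?h = "\<lambda>t. H (cis t)"
  have ch: "continuous_on A ?h" for A
    by (rule continuous_on_compose2[OF H]) (auto intro: continuous_intros)
  have hc: "((\<lambda>t. ?h t * cos (real k * t)) has_integral 0) {0..2 * pi}" for k
    using integrable_integral[of "\<lambda>t. ?h t * cos (real k * t)" "{0..2 * pi}"] c[of k]
    by (simp add: integrable_continuous_real continuous_on_mult ch continuous_on_cos)
  have hs: "((\<lambda>t. ?h t * sin (real k * t)) has_integral 0) {0..2 * pi}" for k
    using integrable_integral[of "\<lambda>t. ?h t * sin (real k * t)" "{0..2 * pi}"] s[of k]
    by (simp add: integrable_continuous_real continuous_on_mult ch continuous_on_sin)
  have null: "fourier_null ?h"
    unfolding fourier_null_def
  proof (intro conjI allI)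
    show "continuous_on {0..2 * pi} ?h"
      by (rule ch)
    fix j :: int
    have cases: "of_int j = real (nat j) \<or> of_int j = - real (nat (- j))"
      by (cases "0 \<le> j") auto
    have neg: "((\<lambda>t. - (?h t * sin (real n * t))) has_integral - 0) {0..2 * pi}" for n
      by (rule has_integral_neg[OF hs])
    show "((\<lambda>t. ?h t * cos (of_int j * t)) has_integral 0) {0..2 * pi}"
      using cases
    proof
      assume j: "of_int j = real (nat j)"
      show ?thesis
        unfolding j by (rule hc)
    next
      assume j: "of_int j = - real (nat (- j))"
      show ?thesis
        unfolding j mult_minus_left cos_minus by (rule hc)
    qed
    show "((\<lambda>t. ?h t * sin (of_int j * t)) has_integral 0) {0..2 * pi}"
      using cases
    proof
      assume j: "of_int j = real (nat j)"
      show ?thesis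
        unfolding j by (rule hs)
    next
      assume j: "of_int j = - real (nat (- j))"
      show ?thesis
        unfolding j mult_minus_left sin_minus mult_minus_right using neg unfolding minus_zero .
    qed
  qed
  have qh: "((\<lambda>t. q (cis t) * ?h t) has_integral 0) {0..2 * pi}" if "real_polynomial_function q" for q
  proof -
    have "((\<lambda>t. q (cis t) * ?h t * cos (of_int 0 * t)) has_integral 0) {0..2 * pi}"
      using fourier_null_polynomial[OF that null] unfolding fourier_null_def by blast
    then show ?thesis
      by simp
  qed
  have ih: "?h integrable_on {0..2 * pi}" "(\<lambda>t. \<bar>?h t\<bar>) integrable_on {0..2 * pi}"
      "(\<lambda>t. ?h t * ?h t) integrable_on {0..2 * pi}"
    by (intro integrable_continuous_real continuous_intros ch)+
  let ?M = "integral {0..2 * pi} (\<lambda>t. \<bar>?h t\<bar>)"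
  have M: "0 \<le> ?M"
    by (intro integral_nonneg ih) auto
  \<comment> \<open>Orthogonality to \<open>q\<close> allows the integral of \<open>?h * ?h\<close>
    to be replaced by that of \<open>(?h - q) * ?h\<close>, where the first factor is below
    \<open>e\<close> in absolute value.\<close>
  have bound: "integral {0..2 * pi} (\<lambda>t. ?h t * ?h t) \<le> e * ?M" if e: "0 < e" for e
  proof -
    obtain q where q: "real_polynomial_function q" "\<And>z. z \<in> sphere 0 1 \<Longrightarrow> \<bar>H z - q z\<bar> < e"
      using Stone_Weierstrass_real_polynomial_function[OF compact_sphere H e] by metis
    have "((\<lambda>t. ?h t * ?h t - q (cis t) * ?h t) has_integral
        integral {0..2 * pi} (\<lambda>t. ?h t * ?h t) - 0) {0..2 * pi}"
      by (intro has_integral_diff qh q integrable_integral ih)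
    moreover have "((\<lambda>t. e * \<bar>?h t\<bar>) has_integral e * ?M) {0..2 * pi}"
      by (intro has_integral_mult_right integrable_integral ih)
    moreover have "?h t * ?h t - q (cis t) * ?h t \<le> e * \<bar>?h t\<bar>" for t
    proof -
      have "?h t * ?h t - q (cis t) * ?h t \<le> \<bar>(?h t - q (cis t)) * ?h t\<bar>"
        by (simp add: left_diff_distrib)
      also have "\<dots> \<le> e * \<bar>?h t\<bar>"
        unfolding abs_mult using q(2)[of "cis t"] by (intro mult_right_mono) auto
      finally show ?thesis .
    qed
    ultimately have "integral {0..2 * pi} (\<lambda>t. ?h t * ?h t) - 0 \<le> e * ?M"
      by (rule has_integral_le)
    then show ?thesis
      by simp
  qed
  have "integral {0..2 * pi} (\<lambda>t. ?h t * ?h t) \<le> 0"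
  proof (rule field_le_epsilon)
    fix e :: real assume "0 < e"
    \<comment> \<open>The denominator \<open>?M + 1\<close> is positive even when \<open>?M\<close>
      is zero.\<close>
    then have "integral {0..2 * pi} (\<lambda>t. ?h t * ?h t) \<le> e / (?M + 1) * ?M"
      using M by (intro bound) auto
    also have "\<dots> \<le> e"
      using M \<open>0 < e\<close> by (simp add: field_simps)
    finally show "integral {0..2 * pi} (\<lambda>t. ?h t * ?h t) \<le> 0 + e"
      by simp
  qed
  moreover have "0 \<le> integral {0..2 * pi} (\<lambda>t. ?h t * ?h t)"
    by (intro integral_nonneg ih) auto
  ultimately have "integral {0..2 * pi} (\<lambda>t. ?h t * ?h t) = 0"
    by simp
  moreover have "continuous_on {0..2 * pi} (\<lambda>t. ?h t * ?h t)"
    by (intro continuous_intros ch)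
  ultimately have "\<forall>t\<in>{0..2 * pi}. ?h t * ?h t = 0"
    using integral_eq_0_iff[of 0 "2 * pi" "\<lambda>t. ?h t * ?h t"] by auto
  then show ?thesis
    using t by auto
qed

section \<open>No eigenvalues other than the numbers \<open>steklov_xi k R\<close>\<close>

context sphere_frame
begin

text \<open>Otherwise \<open>steklov_mode\<close> would annihilate every Fourier coefficient on
  every circle about \<open>p\<close>, and by completeness the eigenfunction would vanish on the
  whole disk.\<close>

lemma steklov_spectrum_subset:
  assumes R: "0 < R" "R < pi" and "\<xi> \<in> steklov_spectrum p R"
  obtains k where "\<xi> = steklov_xi k R"
proof -
  obtain u where "steklov_eigenfunction p R \<xi> u"
    using assms by (auto simp: steklov_spectrum_def)
  then obtain S where S: "open S" "geodesic_disk p R \<subseteq> S" "smooth_on S u"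
    and ne: "\<exists>x\<in>geodesic_disk p R. u x \<noteq> 0"
    and biharm: "\<And>x. x \<in> geodesic_disk p R \<Longrightarrow> sphere_laplacian (sphere_laplacian u) x = 0"
    and bc1: "\<And>x. x \<in> geodesic_circle p R \<Longrightarrow> normal_deriv p R u x = 0"
    and bc2: "\<And>x. x \<in> geodesic_circle p R \<Longrightarrow> normal_deriv p R (sphere_laplacian u) x + \<xi> * u x = 0"
    unfolding steklov_eigenfunction_def by blast
  note mode = steklov_mode[OF S R biharm bc1 bc2]
  show ?thesis
  proof (rule ccontr)
    assume "\<not> thesis"
    then have no: "\<xi> \<noteq> steklov_xi k R" for k
      using that by blast
    have per: "sin (real k * (2 * pi)) = 0" "cos (real k * (2 * pi)) = 1" for k
      using sin_int_2pin[of "int k"] cos_int_2pin[of "int k"] by (simp_all add: mult_ac)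
    have c: "mode (\<lambda>t. cos (real k * t)) u r = 0" if "0 < r" "r \<le> R" for k r
    proof (rule ccontr)
      assume "mode (\<lambda>t. cos (real k * t)) u r \<noteq> 0"
      with that have "\<xi> = steklov_xi k R"
        by (intro mode[where k = k and \<phi>' = "\<lambda>t. - sin (real k * t) * real k"
              and \<phi> = "\<lambda>t. cos (real k * t)"])
          (auto intro!: derivative_eq_intros simp: per power2_eq_square)
      with no show False by blast
    qed
    have s: "mode (\<lambda>t. sin (real k * t)) u r = 0" if "0 < r" "r \<le> R" for k r
    proof (rule ccontr)
      assume "mode (\<lambda>t. sin (real k * t)) u r \<noteq> 0"
      with that have "\<xi> = steklov_xi k R"
        by (intro mode[where k = k and \<phi>' = "\<lambda>t. cos (real k * t) * real k"
              and \<phi> = "\<lambda>t. sin (real k * t)"])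
          (auto intro!: derivative_eq_intros simp: per power2_eq_square)
      with no show False by blast
    qed
    have u0: "u (polar r t) = 0" if r: "0 < r" "r \<le> R" and t: "0 \<le> t" "t \<le> 2 * pi" for r t
    proof -
      \<comment> \<open>The circle of radius \<open>r\<close>, parametrized by unit complex numbers
        as \<open>fourier_complete\<close> requires.\<close>
      let ?X = "\<lambda>z. cos r *\<^sub>R p + sin r *\<^sub>R (Re z *\<^sub>R e1 + Im z *\<^sub>R e2)"
      have X: "?X (cis t) = polar r t" for t
        by (simp add: polar_def dir_def)
      have "?X ` sphere 0 1 \<subseteq> S"
      proof clarify
        fix z :: complex assume "z \<in> sphere 0 1"
        then have "cis (Arg z) = z"
          using cis_Arg[of z] by (force simp: sgn_div_norm)
        then have "?X z = polar r (Arg z)"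
          using X by metis
        then show "?X z \<in> S"
          using polar_in_disk[of r R] r R S by auto
      qed
      then have "continuous_on (sphere 0 1) (\<lambda>z. u (?X z))"
        by (intro continuous_on_compose2[OF smooth_on_imp_continuous_on[OF S(3)]] continuous_intros) auto
      from fourier_complete[OF this, of t] show ?thesis
        using c[OF r] s[OF r] t unfolding X mode_def by simp
    qed
    \<comment> \<open>The coefficients were shown to vanish for positive radii only; the center
      follows by continuity.\<close>
    have "u (polar 0 t) = 0" for t
    proof -
      have cont: "continuous_on {0..R} (\<lambda>r. u (polar r 0))"
        using polar_in_disk R S
        by (intro continuous_on_compose2[OF smooth_on_imp_continuous_on[OF S(3)]] continuous_intros) auto
      have "u (polar 0 0) = 0"
        by (rule continuous_constant_on_closure[of "{0<..R}" "\<lambda>r. u (polar r 0)" 0 0])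
          (use cont R u0 in auto)
      then show ?thesis
        by (simp add: polar_def)
    qed
    with u0 ne show False
      by (metis geodesic_disk_polarE order_le_less)
  qed
qed

end

section \<open>Monotonicity in the radius\<close>

lemma strict_mono_range_unique:
  fixes f g :: "nat \<Rightarrow> 'a::linorder"
  assumes "strict_mono f" "strict_mono g" "range f = range g"
  shows "f = g"
proof
  have le: "g n \<le> f n"
    if h: "strict_mono f" "strict_mono g" "range f = range g" "\<And>i. i < n \<Longrightarrow> f i = g i" for n and f g :: "nat \<Rightarrow> 'a"
  proof -
    obtain i where i: "f n = g i"
      using h(3) by (metis rangeI imageE)
    \<comment> \<open>Otherwise \<open>f n = g i = f i\<close> with \<open>i < n\<close>, against
      strict monotonicity.\<close>
    have "\<not> i < n"
      using h(1,4) i by (metis strict_mono_eq less_irrefl)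
    then show ?thesis
      using i h(2) by (simp add: strict_mono_less_eq)
  qed
  show "f n = g n" for n
  proof (induction n rule: less_induct)
    case (less n)
    show ?case
      using le[OF assms less] le[OF assms(2,1) assms(3)[symmetric], of n] less by fastforce
  qed
qed

text \<open>Since \<open>s \<le> S\<close> on the domain of integration, the integral for
  \<open>Suc k\<close> is at most \<open>S\<close> times that for \<open>k\<close>. Hence
  \<open>S^k\<close> divided by the integral does not decrease in \<open>k\<close>, and the factor
  \<open>k\<^sup>2\<close> makes the growth strict.\<close>

lemma strict_mono_steklov_xi:
  assumes R: "0 < R" "R < pi"
  shows "strict_mono (\<lambda>k. steklov_xi k R)"
proof (rule strict_mono_Suc_iff[THEN iffD2], rule allI)
  fix k
  let ?S = "(tan (R / 2))\<^sup>2"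
  note h = half_angle[OF R]
  have S: "?S > 0"
    using h(1) by simp
  have I: "steklov_integral j ?S > 0" for j
    using steklov_integral_pos[OF S] .
  have "steklov_integral (Suc k) ?S \<le> integral {0..?S} (\<lambda>s. ?S * (s ^ k / (1 + s)\<^sup>2))"
    unfolding steklov_integral_def
  proof (rule integral_le)
    show "(\<lambda>s. s ^ Suc k / (1 + s)\<^sup>2) integrable_on {0..?S}"
      by (intro integrable_continuous_real continuous_on_subset[OF steklov_integrand_continuous]) auto
    show "(\<lambda>s. ?S * (s ^ k / (1 + s)\<^sup>2)) integrable_on {0..?S}"
      by (intro integrable_on_mult_right integrable_continuous_real
          continuous_on_subset[OF steklov_integrand_continuous]) auto
    fix s assume "s \<in> {0..?S}"
    then have "s * (s ^ k / (1 + s)\<^sup>2) \<le> ?S * (s ^ k / (1 + s)\<^sup>2)"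
      by (intro mult_right_mono) auto
    then show "s ^ Suc k / (1 + s)\<^sup>2 \<le> ?S * (s ^ k / (1 + s)\<^sup>2)"
      by simp
  qed
  also have "\<dots> = ?S * steklov_integral k ?S"
    by (simp only: steklov_integral_def integral_mult_right)
  finally have le: "steklov_integral (Suc k) ?S \<le> ?S * steklov_integral k ?S" .
  have "(real k)\<^sup>2 * ?S ^ k / (2 * sin R * steklov_integral k ?S)
      < (real (Suc k))\<^sup>2 * ?S ^ k / (2 * sin R * steklov_integral k ?S)"
    using h(3) I S by (intro divide_strict_right_mono mult_strict_right_mono power_strict_mono) auto
  also have "\<dots> = (real (Suc k))\<^sup>2 * ?S ^ Suc k / (2 * sin R * (?S * steklov_integral k ?S))"
    using h(1) by simp
  also have "\<dots> \<le> (real (Suc k))\<^sup>2 * ?S ^ Suc k / (2 * sin R * steklov_integral (Suc k) ?S)"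
    using h(3) I S le by (intro divide_left_mono mult_left_mono mult_pos_pos) auto
  finally show "steklov_xi k R < steklov_xi (Suc k) R"
    by (simp add: steklov_xi_def)
qed

lemma steklov_xi_pos:
  assumes "0 < R" "R < pi" "1 \<le> m"
  shows "steklov_xi m R > 0"
  using strict_monoD[OF strict_mono_steklov_xi[OF assms(1,2)], of 0 m] assms(3)
  by (simp add: steklov_xi_def)

section \<open>Rational bounds of the integral\<close>

context
  fixes m :: nat
  assumes m: "1 \<le> m"
begin

lemma power_Suc_deriv: "((\<lambda>S::real. S ^ Suc m) has_real_derivative real (Suc m) * S ^ m) (at S)"
  using DERIV_pow[of "Suc m" S] by simp

text \<open>The slope \<open>c\<close> is kept free because both bounds use the same comparison
  function, with \<open>c = a - 2\<close> from above and \<open>c = a - 1/2\<close> from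
  below.\<close>

lemma comparison_deriv:
  fixes S c :: real
  defines "a \<equiv> real (Suc m)"
  assumes "0 \<le> S" "0 \<le> c"
  shows "((\<lambda>S. S ^ Suc m / ((1 + S) * (a + c * S))) has_real_derivative
    S ^ m * (a\<^sup>2 + (a + c) * (a - 1) * S + (a - 2) * c * S\<^sup>2) / ((1 + S) * (a + c * S))\<^sup>2) (at S)"
proof -
  have pos: "1 + S > 0" "a + c * S > 0"
    using assms by (auto intro: add_pos_nonneg)
  have "((\<lambda>S. S ^ Suc m / ((1 + S) * (a + c * S))) has_real_derivative
    (a * S ^ m * ((1 + S) * (a + c * S)) - S ^ Suc m * ((a + c * S) + c * (1 + S)))
      / (((1 + S) * (a + c * S)) * ((1 + S) * (a + c * S)))) (at S)"
    unfolding a_def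
  proof (rule DERIV_divide[OF power_Suc_deriv])
    show "((\<lambda>S. (1 + S) * (real (Suc m) + c * S)) has_real_derivative
        (real (Suc m) + c * S) + c * (1 + S)) (at S)"
      by (auto intro!: derivative_eq_intros simp: algebra_simps)
  qed (use pos a_def in auto)
  also have "a * S ^ m * ((1 + S) * (a + c * S)) - S ^ Suc m * ((a + c * S) + c * (1 + S))
      = S ^ m * (a\<^sup>2 + (a + c) * (a - 1) * S + (a - 2) * c * S\<^sup>2)"
    by (simp add: algebra_simps power2_eq_square)
  finally show ?thesis
    by (simp add: power2_eq_square)
qed

lemma comparison_continuous:
  assumes "0 \<le> c"
  shows "continuous_on {0..S} (\<lambda>S. S ^ Suc m / ((1 + S) * (real (Suc m) + c * S)))"
  using comparison_deriv[OF _ assms]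
  by (intro DERIV_continuous_on[OF has_field_derivative_at_within]) auto

text \<open>Division by \<open>a + (a - 2) S\<close>, positive because \<open>a \<ge> 2\<close>,
  gives a comparison of two functions vanishing at \<open>0\<close>. Over the common denominator
  \<open>?D\<^sup>2\<close> their derivatives differ by \<open>x^m * 2 * x\<close>.\<close>

lemma steklov_integral_less:
  assumes "0 < S"
  shows "(real (Suc m) + (real (Suc m) - 2) * S) * steklov_integral m S < S ^ Suc m / (1 + S)"
proof -
  define a where "a = real (Suc m)"
  let ?G = "\<lambda>S. S ^ Suc m / ((1 + S) * (a + (a - 2) * S))"
  have a: "a \<ge> 2"
    using m by (simp add: a_def)
  have "?G 0 - steklov_integral m 0 < ?G S - steklov_integral m S"
  proof (rule DERIV_pos_imp_increasing_open[OF assms])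
    fix x :: real assume x: "0 < x" "x < S"
    let ?D = "(1 + x) * (a + (a - 2) * x)"
    have D: "a + (a - 2) * x > 0"
      using x a by (intro add_pos_nonneg) auto
    have "x ^ m / (1 + x)\<^sup>2 = x ^ m * (a + (a - 2) * x)\<^sup>2 / ?D\<^sup>2"
      using D by (simp add: power_mult_distrib)
    also have "\<dots> < x ^ m * (a\<^sup>2 + (a + (a - 2)) * (a - 1) * x + (a - 2) * (a - 2) * x\<^sup>2) / ?D\<^sup>2"
    proof (intro divide_strict_right_mono mult_strict_left_mono)
      have "a\<^sup>2 + (a + (a - 2)) * (a - 1) * x + (a - 2) * (a - 2) * x\<^sup>2 - (a + (a - 2) * x)\<^sup>2 = 2 * x"
        by (simp add: algebra_simps power2_eq_square)
      then show "(a + (a - 2) * x)\<^sup>2 < a\<^sup>2 + (a + (a - 2)) * (a - 1) * x + (a - 2) * (a - 2) * x\<^sup>2"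
        using x by linarith
    qed (use x D in auto)
    finally have "0 < x ^ m * (a\<^sup>2 + (a + (a - 2)) * (a - 1) * x + (a - 2) * (a - 2) * x\<^sup>2) / ?D\<^sup>2
        - x ^ m / (1 + x)\<^sup>2"
      by simp
    moreover have "((\<lambda>S. ?G S - steklov_integral m S) has_real_derivative
        x ^ m * (a\<^sup>2 + (a + (a - 2)) * (a - 1) * x + (a - 2) * (a - 2) * x\<^sup>2) / ?D\<^sup>2
        - x ^ m / (1 + x)\<^sup>2) (at x)"
      unfolding a_def by (intro DERIV_diff comparison_deriv steklov_integral_deriv)
        (use x m in auto)
    ultimately show "\<exists>y. ((\<lambda>S. ?G S - steklov_integral m S) has_real_derivative y) (at x) \<and> 0 < y"
      by blast
  next
    show "continuous_on {0..S} (\<lambda>S. ?G S - steklov_integral m S)"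
      unfolding a_def using m
      by (intro continuous_on_diff comparison_continuous steklov_integral_continuous) auto
  qed
  then have "steklov_integral m S < S ^ Suc m / (1 + S) / (a + (a - 2) * S)"
    by simp
  moreover have "a + (a - 2) * S > 0"
    using assms a by (intro add_pos_nonneg) auto
  ultimately show ?thesis
    unfolding a_def[symmetric] by (simp only: pos_less_divide_eq mult.commute)
qed

text \<open>The same comparison in the other direction: for \<open>c = a - 1/2\<close> the
  numerators of the derivatives differ by \<open>x^m\<close> times
  \<open>(3/2 a - 1/2) x + 3/2 c x\<^sup>2\<close>.\<close>

lemma steklov_integral_greater:
  assumes "0 < S"
  shows "(real (Suc m) + (real (Suc m) - 1 / 2) * S) * steklov_integral m S > S ^ Suc m / (1 + S)"
proof -
  define a c where "a = real (Suc m)" and "c = a - 1 / 2"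
  let ?G = "\<lambda>S. S ^ Suc m / ((1 + S) * (a + c * S))"
  have a: "a \<ge> 2" and c: "c > 0"
    using m by (auto simp: a_def c_def)
  have "steklov_integral m 0 - ?G 0 < steklov_integral m S - ?G S"
  proof (rule DERIV_pos_imp_increasing_open[OF assms])
    fix x :: real assume x: "0 < x" "x < S"
    let ?D = "(1 + x) * (a + c * x)"
    have D: "a + c * x > 0"
      using x a c by (intro add_pos_nonneg) auto
    have "x ^ m * (a\<^sup>2 + (a + c) * (a - 1) * x + (a - 2) * c * x\<^sup>2) / ?D\<^sup>2
        < x ^ m * (a + c * x)\<^sup>2 / ?D\<^sup>2"
    proof (intro divide_strict_right_mono mult_strict_left_mono)
      have "(a + c * x)\<^sup>2 - (a\<^sup>2 + (a + c) * (a - 1) * x + (a - 2) * c * x\<^sup>2)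
          = (3 / 2 * a - 1 / 2) * x + 3 / 2 * c * x\<^sup>2"
        unfolding c_def by (simp add: algebra_simps power2_eq_square) (simp add: field_simps)
      moreover have "0 < (3 / 2 * a - 1 / 2) * x + 3 / 2 * c * x\<^sup>2"
        using x a c by (intro add_pos_nonneg) auto
      ultimately show "a\<^sup>2 + (a + c) * (a - 1) * x + (a - 2) * c * x\<^sup>2 < (a + c * x)\<^sup>2"
        by linarith
    qed (use x D in auto)
    also have "\<dots> = x ^ m / (1 + x)\<^sup>2"
      using D by (simp add: power_mult_distrib)
    finally have "0 < x ^ m / (1 + x)\<^sup>2
        - x ^ m * (a\<^sup>2 + (a + c) * (a - 1) * x + (a - 2) * c * x\<^sup>2) / ?D\<^sup>2"
      by simp
    moreover have "((\<lambda>S. steklov_integral m S - ?G S) has_real_derivative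
        x ^ m / (1 + x)\<^sup>2 - x ^ m * (a\<^sup>2 + (a + c) * (a - 1) * x + (a - 2) * c * x\<^sup>2) / ?D\<^sup>2) (at x)"
      unfolding a_def by (intro DERIV_diff comparison_deriv steklov_integral_deriv)
        (use x c in auto)
    ultimately show "\<exists>y. ((\<lambda>S. steklov_integral m S - ?G S) has_real_derivative y) (at x) \<and> 0 < y"
      by blast
  next
    show "continuous_on {0..S} (\<lambda>S. steklov_integral m S - ?G S)"
      unfolding a_def using c
      by (intro continuous_on_diff comparison_continuous steklov_integral_continuous) auto
  qed
  then have "S ^ Suc m / (1 + S) / (a + c * S) < steklov_integral m S"
    by simp
  moreover have "a + c * S > 0"
    using assms a c by (intro add_pos_nonneg) auto
  ultimately show ?thesis
    unfolding a_def[symmetric] c_def[symmetric] by (simp only: pos_divide_less_eq mult.commute)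
qed

section \<open>Monotone profiles in the variable \<open>S\<close>\<close>

lemma sin_cube_profile_decreasing:
  assumes "0 < x" "x < y"
  shows "y ^ Suc m / ((1 + y)\<^sup>2 * steklov_integral m y) < x ^ Suc m / ((1 + x)\<^sup>2 * steklov_integral m x)"
proof (rule DERIV_neg_imp_decreasing[OF assms(2)])
  fix S assume "x \<le> S" "S \<le> y"
  then have S: "0 < S"
    using assms by simp
  let ?J = "steklov_integral m S" and ?a = "real (Suc m)"
  have J: "?J > 0"
    using steklov_integral_pos[OF S] .
  have "((\<lambda>S. S ^ Suc m / ((1 + S)\<^sup>2 * steklov_integral m S)) has_real_derivative
      (?a * S ^ m * ((1 + S)\<^sup>2 * ?J) - S ^ Suc m * (2 * (1 + S) * ?J + S ^ m / (1 + S)\<^sup>2 * (1 + S)\<^sup>2))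
      / (((1 + S)\<^sup>2 * ?J) * ((1 + S)\<^sup>2 * ?J))) (at S)"
  proof (rule DERIV_divide[OF power_Suc_deriv])
    show "((\<lambda>S. (1 + S)\<^sup>2 * steklov_integral m S) has_real_derivative
        2 * (1 + S) * ?J + S ^ m / (1 + S)\<^sup>2 * (1 + S)\<^sup>2) (at S)"
      using S by (auto intro!: derivative_eq_intros steklov_integral_deriv)
  qed (use S J in auto)
  moreover have "(?a * S ^ m * ((1 + S)\<^sup>2 * ?J) - S ^ Suc m * (2 * (1 + S) * ?J + S ^ m / (1 + S)\<^sup>2 * (1 + S)\<^sup>2))
      / (((1 + S)\<^sup>2 * ?J) * ((1 + S)\<^sup>2 * ?J)) < 0"
  proof (rule divide_neg_pos)
    have cancel: "S ^ m / (1 + S)\<^sup>2 * (1 + S)\<^sup>2 = S ^ m" "(1 + S) * (Y - Q / (1 + S)) = (1 + S) * Y - Q" for Y Q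
      using S by (simp_all add: right_diff_distrib)
    \<comment> \<open>Up to positive factors, the numerator of the derivative is the difference of
      the two sides of \<open>steklov_integral_less\<close>.\<close>
    have "?a * S ^ m * ((1 + S)\<^sup>2 * ?J) - S ^ Suc m * (2 * (1 + S) * ?J + S ^ m / (1 + S)\<^sup>2 * (1 + S)\<^sup>2)
        = S ^ m * ((1 + S) * ((?a + (?a - 2) * S) * ?J - S ^ Suc m / (1 + S)))"
      unfolding cancel by (simp add: algebra_simps power2_eq_square)
    also have "\<dots> < 0"
      using steklov_integral_less[OF S] S by (intro mult_pos_neg mult_pos_neg) auto
    finally show "?a * S ^ m * ((1 + S)\<^sup>2 * ?J) - S ^ Suc m * (2 * (1 + S) * ?J + S ^ m / (1 + S)\<^sup>2 * (1 + S)\<^sup>2) < 0" .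
  qed (use S J in auto)
  ultimately show "\<exists>z. ((\<lambda>S. S ^ Suc m / ((1 + S)\<^sup>2 * steklov_integral m S)) has_real_derivative z) (at S) \<and> z < 0"
    by blast
qed

lemma sin_half_cube_profile_increasing:
  assumes "0 < x" "x < y"
  shows "(x ^ Suc m)\<^sup>2 / ((1 + x) * (steklov_integral m x)\<^sup>2) < (y ^ Suc m)\<^sup>2 / ((1 + y) * (steklov_integral m y)\<^sup>2)"
proof (rule DERIV_pos_imp_increasing[OF assms(2)])
  fix S assume "x \<le> S" "S \<le> y"
  then have S: "0 < S"
    using assms by simp
  let ?J = "steklov_integral m S" and ?a = "real (Suc m)"
  let ?N = "2 * S ^ Suc m * (?a * S ^ m) * ((1 + S) * ?J\<^sup>2)
      - (S ^ Suc m)\<^sup>2 * (?J\<^sup>2 + 2 * ?J * (S ^ m / (1 + S)\<^sup>2) * (1 + S))"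
  let ?D = "((1 + S) * ?J\<^sup>2) * ((1 + S) * ?J\<^sup>2)"
  have J: "?J > 0"
    using steklov_integral_pos[OF S] .
  have "((\<lambda>S. (S ^ Suc m)\<^sup>2 / ((1 + S) * (steklov_integral m S)\<^sup>2)) has_real_derivative ?N / ?D) (at S)"
  proof (rule DERIV_divide)
    show "((\<lambda>S. (S ^ Suc m)\<^sup>2) has_real_derivative 2 * S ^ Suc m * (?a * S ^ m)) (at S)"
      using DERIV_power[OF power_Suc_deriv, of 2 S] by (simp add: mult_ac del: power_Suc)
    show "((\<lambda>S. (1 + S) * (steklov_integral m S)\<^sup>2) has_real_derivative
        ?J\<^sup>2 + 2 * ?J * (S ^ m / (1 + S)\<^sup>2) * (1 + S)) (at S)"
      using S by (auto intro!: derivative_eq_intros steklov_integral_deriv simp: mult_ac)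
  qed (use S J in auto)
  moreover have "?N / ?D > 0"
  proof (rule divide_pos_pos)
    \<comment> \<open>Here the numerator is a positive multiple of the difference in
      \<open>steklov_integral_greater\<close>; the \<open>1/2\<close> in the slope is the share of
      \<open>1 + S\<close> in a profile that is a square.\<close>
    have "?N = 2 * S ^ Suc m * S ^ m * ?J * ((?a + (?a - 1 / 2) * S) * ?J - S ^ Suc m / (1 + S))"
    proof -
      have q: "S ^ m / (1 + S)\<^sup>2 * (1 + S) = S ^ m / (1 + S)" "S ^ Suc m / (1 + S) = S * (S ^ m / (1 + S))"
        using S by (simp_all add: power2_eq_square)
      show ?thesis
        unfolding mult.assoc[of "2 * ?J"] q
        by (simp add: algebra_simps power2_eq_square del: times_divide_eq_left times_divide_eq_right)
    qed
    also have "\<dots> > 0"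
      using steklov_integral_greater[OF S] S J by (intro mult_pos_pos) auto
    finally show "?N > 0" .
  qed (use S J in auto)
  ultimately show "\<exists>z. ((\<lambda>S. (S ^ Suc m)\<^sup>2 / ((1 + S) * (steklov_integral m S)\<^sup>2)) has_real_derivative z) (at S) \<and> 0 < z"
    by blast
qed

section \<open>Return to the radius\<close>

lemma tan_half_square_less:
  assumes "0 < r" "r < s" "s < pi"
  shows "0 < (tan (r / 2))\<^sup>2" "(tan (r / 2))\<^sup>2 < (tan (s / 2))\<^sup>2"
proof -
  have "0 < tan (r / 2)"
    using half_angle(1)[of r] assms by simp
  moreover have "tan (r / 2) < tan (s / 2)"
    using assms by (intro tan_monotone) auto
  ultimately show "0 < (tan (r / 2))\<^sup>2" "(tan (r / 2))\<^sup>2 < (tan (s / 2))\<^sup>2"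
    by (auto intro!: power_strict_mono)
qed

text \<open>One factor \<open>sin R\<close> cancels against the denominator of \<open>\<xi>\<close>;
  the other two give \<open>4 S / (1 + S)\<^sup>2\<close>, so everything is rational in
  \<open>S\<close> and the integral.\<close>

lemma xi_sin_cube_decreasing:
  assumes "0 < r" "r < s" "s < pi"
  shows "steklov_xi m s * sin s ^ 3 < steklov_xi m r * sin r ^ 3"
proof -
  have eq: "steklov_xi m r * sin r ^ 3 = 2 * (real m)\<^sup>2 *
      (((tan (r / 2))\<^sup>2) ^ Suc m / ((1 + (tan (r / 2))\<^sup>2)\<^sup>2 * steklov_integral m ((tan (r / 2))\<^sup>2)))"
    if r: "0 < r" "r < pi" for r
  proof -
    let ?S = "(tan (r / 2))\<^sup>2"
    note h = half_angle[OF r]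
    have J: "steklov_integral m ?S > 0"
      using h(1) by (intro steklov_integral_pos) simp
    have sq: "(sin r)\<^sup>2 = 4 * ?S / (1 + ?S)\<^sup>2"
      by (simp add: h(2) power_divide power_mult_distrib)
    have "steklov_xi m r * sin r ^ 3 = (real m)\<^sup>2 * ?S ^ m / (2 * steklov_integral m ?S) * (sin r)\<^sup>2"
      using h(3) by (simp add: steklov_xi_def power3_eq_cube power2_eq_square)
    also have "\<dots> = 2 * (real m)\<^sup>2 * (?S ^ Suc m / ((1 + ?S)\<^sup>2 * steklov_integral m ?S))"
      unfolding sq by (simp add: mult_ac)
    finally show ?thesis .
  qed
  show ?thesis
    unfolding eq[OF assms(1) order_less_trans[OF assms(2,3)]] eq[OF order_less_trans[OF assms(1,2)] assms(3)]
    by (intro mult_strict_left_mono sin_cube_profile_decreasing tan_half_square_less[OF assms]) (use m in simp)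
qed

text \<open>The product involves the square root of \<open>1 + S\<close>, so its square is compared
  instead; nonnegativity undoes the squaring.\<close>

lemma xi_sin_half_cube_increasing:
  assumes "0 < r" "r < s" "s < pi"
  shows "steklov_xi m r * sin (r / 2) ^ 3 < steklov_xi m s * sin (s / 2) ^ 3"
proof -
  have eq: "(steklov_xi m r * sin (r / 2) ^ 3)\<^sup>2 = ((real m)\<^sup>2)\<^sup>2 / 16 *
      ((((tan (r / 2))\<^sup>2) ^ Suc m)\<^sup>2 / ((1 + (tan (r / 2))\<^sup>2) * (steklov_integral m ((tan (r / 2))\<^sup>2))\<^sup>2))"
    if r: "0 < r" "r < pi" for r
  proof -
    define S J where "S = (tan (r / 2))\<^sup>2" and "J = steklov_integral m S"
    note h = half_angle[OF r]
    have S: "S > 0"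
      using h(1) by (simp add: S_def)
    have J: "J > 0"
      using steklov_integral_pos[OF S] by (simp add: J_def)
    have sq: "(sin r)\<^sup>2 = 4 * S / (1 + S)\<^sup>2"
      by (simp add: h(2) S_def power_divide power_mult_distrib)
    have sq2: "(sin (r / 2))\<^sup>2 = S / (1 + S)"
    proof -
      have "1 + S = inverse ((cos (r / 2))\<^sup>2)"
        using tan_sec[of "r / 2"] h(5) by (simp add: S_def power_inverse)
      then show ?thesis
        using h(5) by (simp add: S_def tan_def power_divide)
    qed
    have "(steklov_xi m r * sin (r / 2) ^ 3)\<^sup>2
        = ((real m)\<^sup>2 * S ^ m)\<^sup>2 / (4 * (sin r)\<^sup>2 * J\<^sup>2) * ((sin (r / 2))\<^sup>2) ^ 3"
      by (simp add: steklov_xi_def S_def J_def power_divide power_mult_distrib flip: power_mult)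
    also have "\<dots> = ((real m)\<^sup>2)\<^sup>2 / 16 * ((S ^ Suc m)\<^sup>2 / ((1 + S) * J\<^sup>2))"
    proof -
      have "((real m)\<^sup>2 * S ^ m)\<^sup>2 / (4 * (4 * S / A\<^sup>2) * J\<^sup>2) * (S / A) ^ 3
          = ((real m)\<^sup>2)\<^sup>2 / 16 * ((S ^ Suc m)\<^sup>2 / (A * J\<^sup>2))" if "A > 0" for A
        using S J that by (simp add: field_simps power2_eq_square power3_eq_cube)
      from this[of "1 + S"] show ?thesis
        unfolding sq sq2 using S by simp
    qed
    finally show ?thesis
      by (simp add: S_def J_def)
  qed
  have "(steklov_xi m r * sin (r / 2) ^ 3)\<^sup>2 < (steklov_xi m s * sin (s / 2) ^ 3)\<^sup>2"
    unfolding eq[OF assms(1) order_less_trans[OF assms(2,3)]] eq[OF order_less_trans[OF assms(1,2)] assms(3)]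
    by (intro mult_strict_left_mono sin_half_cube_profile_increasing tan_half_square_less[OF assms]) (use m in simp)
  moreover have "0 \<le> steklov_xi m s * sin (s / 2) ^ 3"
    using steklov_xi_pos[OF _ _ m, of s] assms
    by (intro mult_nonneg_nonneg zero_le_power sin_ge_zero) auto
  ultimately show ?thesis
    by (rule power2_less_imp_less)
qed

lemma xi_tan_half_cube_increasing:
  assumes "0 < r" "r < s" "s < pi"
  shows "steklov_xi m r * tan (r / 2) ^ 3 < steklov_xi m s * tan (s / 2) ^ 3"
proof -
  have c: "cos (s / 2) > 0" "cos (s / 2) < cos (r / 2)"
    using half_angle(5)[of s] assms by (auto intro!: cos_monotone_0_pi)
  have "steklov_xi m r * sin (r / 2) ^ 3 * (1 / cos (r / 2) ^ 3)
      < steklov_xi m s * sin (s / 2) ^ 3 * (1 / cos (s / 2) ^ 3)"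
  proof (rule mult_strict_mono)
    show "1 / cos (r / 2) ^ 3 < 1 / cos (s / 2) ^ 3"
      using c by (intro divide_strict_left_mono power_strict_mono mult_pos_pos zero_less_power) auto
    show "0 < steklov_xi m s * sin (s / 2) ^ 3"
      using steklov_xi_pos[OF _ _ m, of s] assms
      by (intro mult_pos_pos zero_less_power sin_gt_zero) auto
  qed (use xi_sin_half_cube_increasing[OF assms] c in auto)
  then show ?thesis
    by (simp add: tan_def power_divide)
qed

text \<open>The derivative has the sign of \<open>sin (x/2) - x/2 cos (x/2)\<close>, which vanishes
  at \<open>0\<close> and has the positive derivative \<open>x/4 sin (x/2)\<close>.\<close>

lemma divide_sin_half_increasing:
  assumes "0 < r" "r < s" "s < pi"
  shows "r / sin (r / 2) < s / sin (s / 2)"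
proof (rule DERIV_pos_imp_increasing[OF assms(2)])
  fix x assume "r \<le> x" "x \<le> s"
  then have x: "0 < x" "x < pi"
    using assms by auto
  have sx: "sin (x / 2) > 0"
    using x by (intro sin_gt_zero) auto
  have "sin (0 / 2) - 0 / 2 * cos (0 / 2) < sin (x / 2) - x / 2 * cos (x / 2)"
  proof (rule DERIV_pos_imp_increasing_open[OF x(1)])
    fix t assume t: "0 < t" "t < x"
    have "((\<lambda>x. sin (x / 2) - x / 2 * cos (x / 2)) has_real_derivative t / 4 * sin (t / 2)) (at t)"
      by (auto intro!: derivative_eq_intros simp: field_simps)
    moreover have "t / 4 * sin (t / 2) > 0"
      using t x by (intro mult_pos_pos sin_gt_zero) auto
    ultimately show "\<exists>y. ((\<lambda>x. sin (x / 2) - x / 2 * cos (x / 2)) has_real_derivative y) (at t) \<and> 0 < y"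
      by blast
  qed (auto intro!: continuous_intros)
  then have "(sin (x / 2) - x / 2 * cos (x / 2)) / (sin (x / 2))\<^sup>2 > 0"
    using sx by simp
  moreover have "((\<lambda>x. x / sin (x / 2)) has_real_derivative
      (sin (x / 2) - x / 2 * cos (x / 2)) / (sin (x / 2))\<^sup>2) (at x)"
    using sx by (auto intro!: derivative_eq_intros simp: power2_eq_square)
  ultimately show "\<exists>y. ((\<lambda>x. x / sin (x / 2)) has_real_derivative y) (at x) \<and> 0 < y"
    by blast
qed

lemma xi_cube_increasing:
  assumes "0 < r" "r < s" "s < pi"
  shows "steklov_xi m r * r ^ 3 < steklov_xi m s * s ^ 3"
proof -
  have s: "sin (r / 2) > 0" "sin (s / 2) > 0"
    using assms by (auto intro!: sin_gt_zero)
  have "steklov_xi m r * sin (r / 2) ^ 3 * (r / sin (r / 2)) ^ 3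
      < steklov_xi m s * sin (s / 2) ^ 3 * (s / sin (s / 2)) ^ 3"
  proof (rule mult_strict_mono)
    show "(r / sin (r / 2)) ^ 3 < (s / sin (s / 2)) ^ 3"
      using divide_sin_half_increasing[OF assms] assms s by (intro power_strict_mono) auto
    show "0 < steklov_xi m s * sin (s / 2) ^ 3"
      using steklov_xi_pos[OF _ _ m, of s] assms s by simp
  qed (use xi_sin_half_cube_increasing[OF assms] assms s in auto)
  then show ?thesis
    using s by (simp add: power_divide)
qed

end

section \<open>Existence of the eigenfunctions\<close>

text \<open>Coefficients of the power series solution \<open>h\<close> of
  \<open>y (2 - y) h' + (2 k + 2 - 2 y) h = 1\<close>: the constant term fixes the first one, and
  the higher powers of \<open>y\<close> give the recursion.\<close>

fun profile_coeff :: "nat \<Rightarrow> nat \<Rightarrow> real" where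
  "profile_coeff k 0 = 1 / (2 * real k + 2)"
| "profile_coeff k (Suc n) = profile_coeff k n * (real n + 2) / (2 * (real n + real k + 2))"

lemma profile_coeff_pos: "profile_coeff k n > 0"
  by (induction n) (auto intro!: divide_pos_pos mult_pos_pos)

text \<open>Each ratio is at most \<open>1/2\<close>, which gives convergence for
  \<open>\<bar>y\<bar> < 2\<close>; with \<open>y = 1 - cos r\<close> this reaches every point of
  the sphere except \<open>- p\<close>.\<close>

lemma profile_coeff_le: "profile_coeff k n \<le> (1 / 2) ^ n"
proof (induction n)
  case (Suc n)
  have "(real n + 2) / (2 * (real n + real k + 2)) \<le> 1 / 2"
    by (simp add: field_simps)
  then have "profile_coeff k n * ((real n + 2) / (2 * (real n + real k + 2))) \<le> (1 / 2) ^ n * (1 / 2)"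
    using Suc profile_coeff_pos[of k n] by (intro mult_mono) auto
  then show ?case
    by simp
qed auto

text \<open>The derivatives of a primitive \<open>g\<close> of the solution \<open>g'\<close>, regular at \<open>y = 0\<close>, of
  \<open>y (2 - y) g'' + (2 k + 2 - 2 y) g' = 1\<close>. In the variable \<open>y = 1 - cos r\<close> this is the
  equation for \<open>g(y) tan\<^sup>k (r/2)\<close> to have Laplacian \<open>tan\<^sup>k (r/2)\<close> in angular frequency \<open>k\<close>.\<close>

definition profile :: "nat \<Rightarrow> nat \<Rightarrow> real \<Rightarrow> real" where
  "profile k j y = (\<Sum>n. (diffs ^^ j) (\<lambda>n. if n = 0 then 0 else profile_coeff k (n - 1) / real n) n * y ^ n)"

lemma profile_summable:
  fixes y :: real
  assumes "\<bar>y\<bar> < 2"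
  shows "summable (\<lambda>n. (diffs ^^ j) (\<lambda>n. if n = 0 then 0 else profile_coeff k (n - 1) / real n) n * y ^ n)"
  using assms
proof (induction j arbitrary: y)
  case 0
  let ?c = "\<lambda>n. if n = 0 then 0 else profile_coeff k (n - 1) / real n"
  \<comment> \<open>The factor \<open>2\<close> absorbs the index shift of the primitive.\<close>
  have c: "\<bar>?c n\<bar> \<le> 2 * (1 / 2) ^ n" for n
  proof (cases n)
    case (Suc m)
    have "profile_coeff k m / real (Suc m) \<le> profile_coeff k m"
      using profile_coeff_pos[of k m] by (simp add: field_simps)
    then show ?thesis
      using profile_coeff_le[of k m] profile_coeff_pos[of k m] Suc by simp
  qed auto
  have "summable (\<lambda>n. ?c n * y ^ n)"
  proof (rule summable_comparison_test')
    show "summable (\<lambda>n. 2 * (\<bar>y\<bar> / 2) ^ n)"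
      using 0 by (intro summable_mult summable_geometric) auto
    fix n
    have "\<bar>?c n\<bar> * \<bar>y\<bar> ^ n \<le> 2 * (1 / 2) ^ n * \<bar>y\<bar> ^ n"
      using c by (intro mult_right_mono) auto
    then show "norm (?c n * y ^ n) \<le> 2 * (\<bar>y\<bar> / 2) ^ n"
      by (simp add: abs_mult power_abs power_divide)
  qed
  then show ?case
    by simp
next
  case (Suc j)
  show ?case
    using termdiff_converges[of y 2] Suc by simp
qed

lemma profile_deriv:
  assumes "\<bar>y\<bar> < 2"
  shows "(profile k j has_real_derivative profile k (Suc j) y) (at y)"
  using termdiffs_strong'[of 2 _ y] profile_summable[of _ j k] assms
  by (simp add: profile_def[abs_def])

lemma profile_1_sums:
  assumes "\<bar>y\<bar> < 2"
  shows "(\<lambda>n. profile_coeff k n * y ^ n) sums profile k 1 y"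
  using summable_sums[OF profile_summable[OF assms, of 1 k]]
  by (simp add: profile_def diffs_def)

lemma profile_1_pos:
  assumes "0 < y" "y < 2"
  shows "profile k 1 y > 0"
proof -
  have "(\<lambda>n. profile_coeff k n * y ^ n) sums profile k 1 y"
    using assms by (intro profile_1_sums) auto
  then show ?thesis
    using suminf_pos[of "\<lambda>n. profile_coeff k n * y ^ n"] profile_coeff_pos[of k] assms
    by (auto simp: sums_iff)
qed

text \<open>Regrouped as \<open>2 y h' + (2 k + 2) h = 1 + y (y h' + 2 h)\<close>, the equation says
  that the series on the left, with its zeroth term \<open>1\<close> removed, is the series
  \<open>y (y h' + 2 h)\<close>; termwise this is the recursion.\<close>

lemma profile_ode:
  assumes "\<bar>y\<bar> < 2"
  shows "y * (2 - y) * profile k 2 y + (2 * real k + 2 - 2 * y) * profile k 1 y = 1"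
proof -
  let ?b = "profile_coeff k" and ?h = "profile k 1 y" and ?h' = "profile k 2 y"
  note h = profile_1_sums[OF assms, of k]
  have "(\<lambda>n. real (Suc n) * ?b (Suc n) * y ^ n) sums ?h'"
    using summable_sums[OF profile_summable[OF assms, of 2 k]]
    by (simp add: profile_def diffs_def numeral_2_eq_2)
  from sums_mult[OF this, of y] have "(\<lambda>n. real (Suc n) * ?b (Suc n) * y ^ Suc n) sums (y * ?h')"
    by (simp add: mult_ac)
  from sums_Suc[where f = "\<lambda>n. real n * ?b n * y ^ n", OF this]
  have s: "(\<lambda>n. real n * ?b n * y ^ n) sums (y * ?h')"
    by simp
  let ?T = "\<lambda>n. 2 * (real n * ?b n * y ^ n) + (2 * real k + 2) * (?b n * y ^ n)"
  have T: "?T sums (2 * (y * ?h') + (2 * real k + 2) * ?h)"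
    by (intro sums_add sums_mult s h)
  have "(\<lambda>n. y * (real n * ?b n * y ^ n + 2 * (?b n * y ^ n))) sums (y * (y * ?h' + 2 * ?h))"
    by (intro sums_add sums_mult s h)
  moreover have "y * (real n * ?b n * y ^ n + 2 * (?b n * y ^ n)) = ?T (Suc n)" for n
  proof -
    have "2 * (real n + real k + 2) * ?b (Suc n) = ?b n * (real n + 2)"
      by (simp add: add_nonneg_eq_0_iff)
    then have "y ^ Suc n * (2 * (real n + real k + 2) * ?b (Suc n)) = y ^ Suc n * (?b n * (real n + 2))"
      by simp
    then show ?thesis
      by (simp add: algebra_simps del: profile_coeff.simps)
  qed
  ultimately have "(\<lambda>n. ?T (Suc n)) sums (y * (y * ?h' + 2 * ?h))"
    by simp
  from sums_Suc[OF this] have "?T sums (y * (y * ?h' + 2 * ?h) + 1)"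
    by (simp add: add_nonneg_eq_0_iff)
  with T have "2 * (y * ?h') + (2 * real k + 2) * ?h = y * (y * ?h' + 2 * ?h) + 1"
    by (rule sums_unique2)
  then show ?thesis
    by (simp add: algebra_simps)
qed

lemma inverse_power_deriv:
  fixes c :: real
  assumes "1 + c \<noteq> 0"
  shows "((\<lambda>c. (- 1) ^ j * fact j / (1 + c) ^ Suc j) has_real_derivative
    (- 1) ^ Suc j * fact (Suc j) / (1 + c) ^ Suc (Suc j)) (at c)"
proof -
  have "((\<lambda>c. (1 + c) ^ Suc j) has_real_derivative real (Suc j) * (1 + c) ^ j) (at c)"
    using DERIV_power[OF DERIV_add[OF DERIV_const DERIV_ident], of 1 "Suc j" c UNIV] by simp
  then have "((\<lambda>c. (- 1) ^ j * fact j / (1 + c) ^ Suc j) has_real_derivative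
      (0 * (1 + c) ^ Suc j - (- 1) ^ j * fact j * (real (Suc j) * (1 + c) ^ j))
      / ((1 + c) ^ Suc j * (1 + c) ^ Suc j)) (at c)"
    using assms by (intro DERIV_divide DERIV_const) auto
  also have "(0 * (1 + c) ^ Suc j - (- 1) ^ j * fact j * (real (Suc j) * (1 + c) ^ j))
      / ((1 + c) ^ Suc j * (1 + c) ^ Suc j) = (- 1) ^ Suc j * fact (Suc j) / (1 + c) ^ Suc (Suc j)"
  proof -
    have "(0 * A ^ Suc j - (- 1) ^ j * fact j * (real (Suc j) * A ^ j)) / (A ^ Suc j * A ^ Suc j)
        = (- 1) ^ Suc j * fact (Suc j) / A ^ Suc (Suc j)" if "A \<noteq> 0" for A :: real
      using that by (simp add: field_simps)
    from this[OF assms] show ?thesis .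
  qed
  finally show ?thesis .
qed

section \<open>Separated biharmonic functions\<close>

context sphere_frame
begin

text \<open>With \<open>sin r f' = k f + Q\<close> the operator \<open>sin\<^sup>2 f'' + sin cos f' - k\<^sup>2 f\<close> becomes
  \<open>sin r Q' + k Q\<close>.\<close>

lemma laplacian_separated:
  fixes u :: "real^3 \<Rightarrow> real" and f Q Q' :: "real \<Rightarrow> real"
  assumes S: "open S" "smooth_on S u"
    and polar: "\<And>r t. 0 < r \<Longrightarrow> r < pi \<Longrightarrow> polar r t \<in> S"
    and u: "\<And>r t. 0 < r \<Longrightarrow> r < pi \<Longrightarrow> u (polar r t) = f r * cos (real k * t)"
    and f: "\<And>r. 0 < r \<Longrightarrow> r < pi \<Longrightarrow> (f has_real_derivative (Q r + real k * f r) / sin r) (at r)"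
    and Q: "\<And>r. 0 < r \<Longrightarrow> r < pi \<Longrightarrow> (Q has_real_derivative Q' r) (at r)"
    and r: "0 < r" "r < pi"
  shows "grad u (polar r t) \<bullet> polar_r r t = (Q r + real k * f r) / sin r * cos (real k * t)"
    "(sin r)\<^sup>2 * sphere_laplacian u (polar r t) = (sin r * Q' r + real k * Q r) * cos (real k * t)"
proof -
  let ?f' = "\<lambda>r. (Q r + real k * f r) / sin r"
  let ?c = "cos (real k * t)"
  have ev: "r \<in> {0<..<pi}" and op: "open {0<..<pi::real}"
    using r by auto
  \<comment> \<open>Each polar derivative of \<open>u\<close> is computed both from the ambient
    gradient and from the product form; uniqueness of derivatives equates the results.\<close>
  have g: "grad u (polar r t) \<bullet> polar_r r t = ?f' r * cos (real k * t)" if r: "0 < r" "r < pi" for r t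
  proof (rule DERIV_unique)
    show "((\<lambda>r. u (polar r t)) has_real_derivative grad u (polar r t) \<bullet> polar_r r t) (at r)"
      by (rule deriv_r[OF S polar[OF r]])
    show "((\<lambda>r. u (polar r t)) has_real_derivative ?f' r * cos (real k * t)) (at r)"
    proof (rule has_field_derivative_transform_within_open)
      show "((\<lambda>r. f r * cos (real k * t)) has_real_derivative ?f' r * cos (real k * t)) (at r)"
        by (intro DERIV_cmult_right f r)
      show "open {0<..<pi}" "r \<in> {0<..<pi}"
        using r by auto
    qed (use u in auto)
  qed
  from g[OF r] show "grad u (polar r t) \<bullet> polar_r r t = ?f' r * cos (real k * t)" .
  have s: "sin r \<noteq> 0"
    using half_angle(3)[OF r] by simp
  define f'' where "f'' = ((Q' r + real k * ?f' r) * sin r - (Q r + real k * f r) * cos r) / (sin r * sin r)"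
  have f': "(?f' has_real_derivative f'') (at r)"
    unfolding f''_def
    by (intro DERIV_divide DERIV_add DERIV_cmult Q f r DERIV_sin s)
  have rr: "hess u (polar r t) (polar_r r t) - grad u (polar r t) \<bullet> polar r t = f'' * ?c"
  proof (rule DERIV_unique)
    show "((\<lambda>r. grad u (polar r t) \<bullet> polar_r r t) has_real_derivative
        hess u (polar r t) (polar_r r t) - grad u (polar r t) \<bullet> polar r t) (at r)"
      by (rule deriv_rr[OF S polar[OF r]])
    show "((\<lambda>r. grad u (polar r t) \<bullet> polar_r r t) has_real_derivative f'' * ?c) (at r)"
      by (rule has_field_derivative_transform_within_open[OF DERIV_cmult_right[OF f'] op ev])
        (use g in auto)
  qed
  have t: "sin r * (grad u (polar r t) \<bullet> dir' t) = f r * (- sin (real k * t) * real k)" for t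
  proof (rule DERIV_unique)
    show "((\<lambda>t. u (polar r t)) has_real_derivative sin r * (grad u (polar r t) \<bullet> dir' t)) (at t)"
      by (rule deriv_t[OF S polar[OF r]])
    show "((\<lambda>t. u (polar r t)) has_real_derivative f r * (- sin (real k * t) * real k)) (at t)"
      unfolding u[OF r] by (auto intro!: derivative_eq_intros)
  qed
  have tt: "sin r * (sin r * hess u (polar r t) (dir' t) - grad u (polar r t) \<bullet> dir t)
      = - (real k)\<^sup>2 * f r * ?c"
  proof (rule DERIV_unique)
    show "((\<lambda>t. sin r * (grad u (polar r t) \<bullet> dir' t)) has_real_derivative
        sin r * (sin r * hess u (polar r t) (dir' t) - grad u (polar r t) \<bullet> dir t)) (at t)"
      by (rule deriv_tt[OF S polar[OF r]])
    show "((\<lambda>t. sin r * (grad u (polar r t) \<bullet> dir' t)) has_real_derivative - (real k)\<^sup>2 * f r * ?c) (at t)"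
      unfolding t by (auto intro!: derivative_eq_intros simp: power2_eq_square)
  qed
  have "(sin r)\<^sup>2 * sphere_laplacian u (polar r t)
      = (sin r)\<^sup>2 * (f'' * ?c) + sin r * cos r * (?f' r * ?c) + - (real k)\<^sup>2 * f r * ?c"
    using laplacian_polar[OF S polar[OF r, of t]] unfolding rr tt g[OF r] by simp
  also have "\<dots> = ((sin r)\<^sup>2 * f'' + sin r * cos r * ?f' r - (real k)\<^sup>2 * f r) * ?c"
    by (simp add: algebra_simps)
  also have "(sin r)\<^sup>2 * f'' + sin r * cos r * ?f' r - (real k)\<^sup>2 * f r = sin r * Q' r + real k * Q r"
    using s unfolding f''_def by (simp add: field_simps power2_eq_square)
  finally show "(sin r)\<^sup>2 * sphere_laplacian u (polar r t) = (sin r * Q' r + real k * Q r) * ?c" .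
qed

text \<open>The slab in which the power series in \<open>1 - x \<bullet> p\<close> converge; it contains the sphere without \<open>- p\<close>.\<close>

definition cap :: "(real^3) set" where
  "cap = {x. x \<bullet> p \<in> {-1<..<3}}"

text \<open>On the sphere
  \<open>(x \<bullet> e1 + \<i> x \<bullet> e2) / (1 + x \<bullet> p)\<close> is the stereographic
  coordinate from \<open>- p\<close>, of modulus \<open>tan (r/2)\<close> and argument
  \<open>t\<close>. Its powers give \<open>tan\<^sup>k (r/2) cos (k t)\<close> in a form that is
  smooth across \<open>p\<close>. The constant \<open>C\<close> adds a multiple of this harmonic
  function.\<close>

definition mode_function :: "nat \<Rightarrow> real \<Rightarrow> real^3 \<Rightarrow> real" where
  "mode_function k C x = (profile k 0 (1 - x \<bullet> p) + C) * (1 / (1 + x \<bullet> p)) ^ k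
     * Re (((x \<bullet> e1) *\<^sub>R 1 + (x \<bullet> e2) *\<^sub>R \<i>) ^ k)"

lemma open_cap: "open cap"
proof -
  have "cap = (\<lambda>x. x \<bullet> p) -` {-1<..<3}"
    by (auto simp: cap_def)
  then show ?thesis
    by (simp add: open_vimage continuous_on_inner)
qed

lemma smooth_on_mode_function: "smooth_on cap (mode_function k C)"
proof -
  have bl: "bounded_linear (\<lambda>x. x \<bullet> v)" for v :: "real^3"
    by (rule bounded_linear_inner_left)
  have "smooth_on cap (\<lambda>x. (- 1) ^ 0 * profile k 0 (1 - x \<bullet> p))"
  proof (rule smooth_on_compose_bounded_linear[OF bl open_cap, where f = "\<lambda>j c. (- 1) ^ j * profile k j (1 - c)"])
    fix j and x :: "real^3" assume "x \<in> cap"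
    then have "\<bar>1 - x \<bullet> p\<bar> < 2"
      by (auto simp: cap_def)
    moreover have "((\<lambda>c. 1 - c) has_real_derivative - 1) (at (x \<bullet> p))"
      by (auto intro!: derivative_eq_intros)
    ultimately have "((\<lambda>c. profile k j (1 - c)) has_real_derivative profile k (Suc j) (1 - x \<bullet> p) * - 1) (at (x \<bullet> p))"
      by (intro DERIV_chain2[where f = "profile k j" and g = "\<lambda>c. 1 - c"] profile_deriv)
    from DERIV_cmult[OF this, of "(- 1) ^ j"]
    show "((\<lambda>c. (- 1) ^ j * profile k j (1 - c)) has_real_derivative
        (- 1) ^ Suc j * profile k (Suc j) (1 - x \<bullet> p)) (at (x \<bullet> p))"
      by simp
  qed
  then have 1: "smooth_on cap (\<lambda>x. profile k 0 (1 - x \<bullet> p))"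
    by simp
  have "smooth_on cap (\<lambda>x. (- 1) ^ 0 * fact 0 / (1 + x \<bullet> p) ^ Suc 0)"
    by (rule smooth_on_compose_bounded_linear[OF bl open_cap,
          where f = "\<lambda>j c. (- 1) ^ j * fact j / (1 + c) ^ Suc j"], rule inverse_power_deriv)
      (auto simp: cap_def)
  then have 2: "smooth_on cap (\<lambda>x. 1 / (1 + x \<bullet> p))"
    by simp
  have 3: "smooth_on cap (\<lambda>x. ((x \<bullet> e1) *\<^sub>R 1 + (x \<bullet> e2) *\<^sub>R \<i>) ^ k)"
    by (intro smooth_on_power smooth_on_add smooth_on_scaleR smooth_on_inner smooth_on_ident
        smooth_on_const open_cap)
  show ?thesis
    unfolding mode_function_def[abs_def]
    by (intro smooth_on_mult smooth_on_add smooth_on_power smooth_on_const open_cap 1 2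
        smooth_on_bounded_linear[OF bounded_linear_Re] 3)
qed

lemma polar_cap: "0 \<le> r \<Longrightarrow> r < pi \<Longrightarrow> polar r t \<in> cap"
  using cos_monotone_0_pi[of r pi] cos_le_one[of r]
  by (simp add: cap_def inner_commute[of "polar r t"] order_le_less_trans[of "cos r" 1 3])

lemma mode_function_polar:
  "mode_function k C (polar r t) = (profile k 0 (1 - cos r) + C) * tan (r / 2) ^ k * cos (real k * t)"
proof -
  have "polar r t \<bullet> e1 = sin r * cos t" "polar r t \<bullet> e2 = sin r * sin t"
    by (simp_all add: polar_def dir_def inner_add_left)
  then have "(polar r t \<bullet> e1) *\<^sub>R 1 + (polar r t \<bullet> e2) *\<^sub>R \<i> = rcis (sin r) t"
    by (simp add: complex_eq_iff)
  then have "Re (((polar r t \<bullet> e1) *\<^sub>R 1 + (polar r t \<bullet> e2) *\<^sub>R \<i>) ^ k) = sin r ^ k * cos (real k * t)"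
    by (simp add: DeMoivre2)
  moreover have "tan (r / 2) = 1 / (1 + cos r) * sin r"
    using tan_half[of "r / 2"] by (simp add: add.commute)
  then have "tan (r / 2) ^ k = (1 / (1 + cos r)) ^ k * sin r ^ k"
    by (simp only: power_mult_distrib)
  ultimately show ?thesis
    by (simp add: mode_function_def inner_commute[of _ p] mult.assoc)
qed

text \<open>Here \<open>Q = sin\<^sup>2 r tan\<^sup>k (r/2) g'(1 - cos r)\<close> for the series
  \<open>g\<close>, and \<open>sin r Q' + k Q\<close> equals
  \<open>sin\<^sup>2 r tan\<^sup>k (r/2)\<close> times the left side of \<open>profile_ode\<close>
  at \<open>y = 1 - cos r\<close>.\<close>

lemma mode_function_laplacian:
  assumes r: "0 < r" "r < pi"
  shows "grad (mode_function k C) (polar r t) \<bullet> polar_r r t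
      = ((sin r)\<^sup>2 * tan (r / 2) ^ k * profile k 1 (1 - cos r)
        + real k * ((profile k 0 (1 - cos r) + C) * tan (r / 2) ^ k)) / sin r * cos (real k * t)"
    and "sphere_laplacian (mode_function k C) (polar r t) = tan (r / 2) ^ k * cos (real k * t)"
proof -
  let ?f = "\<lambda>r. (profile k 0 (1 - cos r) + C) * tan (r / 2) ^ k"
  let ?Q = "\<lambda>r. (sin r)\<^sup>2 * tan (r / 2) ^ k * profile k 1 (1 - cos r)"
  let ?Q' = "\<lambda>r. ((2 * sin r * cos r) * tan (r / 2) ^ k + real k * tan (r / 2) ^ k / sin r * (sin r)\<^sup>2)
      * profile k 1 (1 - cos r) + profile k 2 (1 - cos r) * sin r * ((sin r)\<^sup>2 * tan (r / 2) ^ k)"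
  have y: "\<bar>1 - cos r\<bar> < 2" if "0 < r" "r < pi" for r
    using that cos_monotone_0_pi[of r pi] cos_le_one[of r] by simp
  have dp: "((\<lambda>r. profile k j (1 - cos r)) has_real_derivative profile k (Suc j) (1 - cos r) * sin r) (at r)"
    if "0 < r" "r < pi" for r j
    by (rule DERIV_chain2[where f = "profile k j" and g = "\<lambda>r. 1 - cos r", OF profile_deriv[OF y[OF that]]]) (auto intro!: derivative_eq_intros)
  have f: "(?f has_real_derivative (?Q r + real k * ?f r) / sin r) (at r)" if r: "0 < r" "r < pi" for r
  proof -
    have "(?f has_real_derivative (profile k (Suc 0) (1 - cos r) * sin r + 0) * tan (r / 2) ^ k
        + real k * tan (r / 2) ^ k / sin r * (profile k 0 (1 - cos r) + C)) (at r)"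
      by (intro DERIV_mult DERIV_add DERIV_const dp tan_half_power_deriv r)
    also have "(profile k (Suc 0) (1 - cos r) * sin r + 0) * tan (r / 2) ^ k
        + real k * tan (r / 2) ^ k / sin r * (profile k 0 (1 - cos r) + C) = (?Q r + real k * ?f r) / sin r"
      using half_angle(3)[OF r] by (simp add: field_simps power2_eq_square)
    finally show ?thesis .
  qed
  have Q: "(?Q has_real_derivative ?Q' r) (at r)" if r: "0 < r" "r < pi" for r
  proof -
    have "((\<lambda>r. (sin r)\<^sup>2) has_real_derivative 2 * sin r * cos r) (at r)"
      by (auto intro!: derivative_eq_intros)
    moreover have "((\<lambda>r. profile k 1 (1 - cos r)) has_real_derivative profile k 2 (1 - cos r) * sin r) (at r)"
      using dp[OF r, of 1] by (simp add: numeral_2_eq_2)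
    ultimately show ?thesis
      by (intro DERIV_mult tan_half_power_deriv r)
  qed
  note sep = laplacian_separated[where u = "mode_function k C" and f = ?f and Q = ?Q and Q' = ?Q',
      OF open_cap smooth_on_mode_function polar_cap[OF less_imp_le] mode_function_polar f Q r, of t]
  show "grad (mode_function k C) (polar r t) \<bullet> polar_r r t = (?Q r + real k * ?f r) / sin r * cos (real k * t)"
    by (rule sep(1))
  have s: "sin r > 0"
    using half_angle(3)[OF r] .
  have "(sin r)\<^sup>2 * sphere_laplacian (mode_function k C) (polar r t)
      = (sin r * ?Q' r + real k * ?Q r) * cos (real k * t)"
    by (rule sep(2))
  also have "sin r * ?Q' r + real k * ?Q r = (sin r)\<^sup>2 * tan (r / 2) ^ k *
      ((sin r)\<^sup>2 * profile k 2 (1 - cos r) + (2 * real k + 2 * cos r) * profile k 1 (1 - cos r))"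
    using s by (simp add: field_simps power2_eq_square)
  also have "(sin r)\<^sup>2 * profile k 2 (1 - cos r) + (2 * real k + 2 * cos r) * profile k 1 (1 - cos r) = 1"
  proof -
    have "(sin r)\<^sup>2 = (1 - cos r) * (2 - (1 - cos r))"
      by (simp add: sin_squared_eq algebra_simps power2_eq_square)
    moreover have "2 * real k + 2 * cos r = 2 * real k + 2 - 2 * (1 - cos r)"
      by simp
    ultimately show ?thesis
      using profile_ode[OF y[OF r], of k] by simp
  qed
  finally show "sphere_laplacian (mode_function k C) (polar r t) = tan (r / 2) ^ k * cos (real k * t)"
    using s by simp
qed

text \<open>The Laplacian is again separated, now with \<open>Q = 0\<close>, so applying the
  operator once more gives zero. At the center, outside the range of the polar computation, the
  claim follows by continuity.\<close>

lemma mode_function_bilaplacian: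
  assumes r: "0 \<le> r" "r < pi"
  shows "sphere_laplacian (sphere_laplacian (mode_function k C)) (polar r t) = 0"
    and "0 < r \<Longrightarrow> grad (sphere_laplacian (mode_function k C)) (polar r t) \<bullet> polar_r r t
      = real k * tan (r / 2) ^ k / sin r * cos (real k * t)"
proof -
  let ?L = "sphere_laplacian (mode_function k C)"
  have L: "smooth_on cap ?L"
    by (intro smooth_on_sphere_laplacian open_cap smooth_on_mode_function)
  have f: "((\<lambda>r. tan (r / 2) ^ k) has_real_derivative (0 + real k * tan (r / 2) ^ k) / sin r) (at r)"
    if "0 < r" "r < pi" for r
    using tan_half_power_deriv[OF that] by simp
  note sep = laplacian_separated[where u = ?L and f = "\<lambda>r. tan (r / 2) ^ k" and Q = "\<lambda>r. 0" and Q' = "\<lambda>r. 0",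
      OF open_cap L polar_cap[OF less_imp_le] mode_function_laplacian(2) f DERIV_const]
  show "grad ?L (polar r t) \<bullet> polar_r r t = real k * tan (r / 2) ^ k / sin r * cos (real k * t)" if "0 < r"
  proof -
    have "grad ?L (polar r t) \<bullet> polar_r r t = (0 + real k * tan (r / 2) ^ k) / sin r * cos (real k * t)"
      by (rule sep(1)) (use that r in auto)
    then show ?thesis
      by simp
  qed
  have pos: "sphere_laplacian ?L (polar r t) = 0" if "0 < r" "r < pi" for r
  proof -
    have "(sin r)\<^sup>2 * sphere_laplacian ?L (polar r t) = (sin r * 0 + real k * 0) * cos (real k * t)"
      by (rule sep(2)) (use that in auto)
    then show ?thesis
      using half_angle(3)[OF that] by simp
  qed
  have cl: "closure {0<..<pi / 2} = {0..pi / 2}"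
    by simp
  have sub: "polar r t \<in> cap" if "r \<in> {0..pi / 2}" for r
  proof (rule polar_cap)
    show "0 \<le> r" "r < pi"
      using that pi_gt_zero unfolding atLeastAtMost_iff by linarith+
  qed
  have cont: "continuous_on {0..pi / 2} (\<lambda>r. sphere_laplacian ?L (polar r t))"
    by (rule continuous_on_compose2[OF smooth_on_imp_continuous_on[OF smooth_on_sphere_laplacian[OF open_cap L]]])
      (auto intro!: continuous_intros sub simp del: atLeastAtMost_iff)
  have "sphere_laplacian ?L (polar 0 t) = 0"
    by (rule continuous_constant_on_closure[of "{0<..<pi / 2}" "\<lambda>r. sphere_laplacian ?L (polar r t)" 0 0])
      (use cont pos in \<open>auto simp: cl\<close>)
  with pos r show "sphere_laplacian ?L (polar r t) = 0"
    by (cases "r = 0") auto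
qed

lemma steklov_xi_in_spectrum:
  assumes R: "0 < R" "R < pi" and k: "1 \<le> k"
  shows "steklov_xi k R \<in> steklov_spectrum p R"
proof -
  let ?y = "1 - cos R" and ?T = "tan (R / 2)"
  note h = half_angle[OF R]
  have y: "0 < ?y" "?y < 2"
    using cos_monotone_0_pi[of 0 R] cos_monotone_0_pi[of R pi] R by auto
  have g: "profile k 1 ?y > 0"
    by (rule profile_1_pos[OF y])
  \<comment> \<open>Chosen so that the radial derivative of \<open>?u\<close> vanishes at
    \<open>R\<close>.\<close>
  define C where "C = - profile k 0 ?y - profile k 1 ?y * (sin R)\<^sup>2 / real k"
  \<comment> \<open>The value demanded by the second boundary condition, still expressed by the
    series.\<close>
  define \<xi> where "\<xi> = (real k)\<^sup>2 / (profile k 1 ?y * sin R ^ 3)"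
  let ?u = "mode_function k C"
  have gC: "profile k 0 ?y + C = - (profile k 1 ?y * (sin R)\<^sup>2 / real k)"
    by (simp add: C_def)
  have uR: "?u (polar R t) = - (profile k 1 ?y * (sin R)\<^sup>2 / real k) * ?T ^ k * cos (real k * t)" for t
    unfolding mode_function_polar gC ..
  have disk: "geodesic_disk p R \<subseteq> cap"
    using polar_cap R by (auto elim!: geodesic_disk_polarE)
  have sR: "sin R \<noteq> 0"
    using h(3) by simp
  have biharm: "sphere_laplacian (sphere_laplacian ?u) x = 0" if "x \<in> geodesic_disk p R" for x
    using that R by (elim geodesic_disk_polarE) (auto intro!: mode_function_bilaplacian)
  have bc1: "normal_deriv p R ?u x = 0" if circle: "x \<in> geodesic_circle p R" for x
  proof -
    obtain t where x: "x = polar R t"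
      using geodesic_circle_polarE[OF circle] by metis
    show ?thesis
      unfolding x normal_deriv_polar[OF sR] mode_function_laplacian(1)[OF R] gC using k by simp
  qed
  have bc2: "normal_deriv p R (sphere_laplacian ?u) x + \<xi> * ?u x = 0" if circle: "x \<in> geodesic_circle p R" for x
  proof -
    obtain t where x: "x = polar R t"
      using geodesic_circle_polarE[OF circle] by metis
    have R': "0 \<le> R"
      using R by simp
    have "normal_deriv p R (sphere_laplacian ?u) x = real k * ?T ^ k / sin R * cos (real k * t)"
      unfolding x normal_deriv_polar[OF sR] by (rule mode_function_bilaplacian(2)[OF R' R(2) R(1)])
    moreover have "\<xi> * ?u x = - (real k * ?T ^ k / sin R * cos (real k * t))"
      unfolding x uR \<xi>_def using g k sR by (simp add: field_simps power2_eq_square power3_eq_cube)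
    ultimately show ?thesis
      by simp
  qed
  have c0: "profile k 1 ?y * (sin R)\<^sup>2 / real k * ?T ^ k \<noteq> 0"
    using g sR k h(1) by simp
  have "steklov_eigenfunction p R \<xi> ?u"
    unfolding steklov_eigenfunction_def
  proof (intro conjI ballI)
    show "\<exists>U. open U \<and> geodesic_disk p R \<subseteq> U \<and> smooth_on U ?u"
      using open_cap disk smooth_on_mode_function by blast
    have "?u (polar R 0) \<noteq> 0"
      unfolding uR using g sR k h(1) by simp
    then show "\<exists>x\<in>geodesic_disk p R. ?u x \<noteq> 0"
      using polar_in_disk[of R R 0] R by auto
  qed (use biharm bc1 bc2 in auto)
  \<comment> \<open>Applying \<open>steklov_mode\<close> to \<open>?u\<close> itself yields the
    closed form; its cosine coefficient at \<open>R\<close> is a nonzero multiple of the integral of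
    \<open>cos\<^sup>2 (k t)\<close>.\<close>
  moreover have "\<xi> = steklov_xi k R"
  proof (rule steklov_mode[OF open_cap disk smooth_on_mode_function R biharm bc1 bc2,
        where \<phi> = "\<lambda>t. cos (real k * t)" and \<phi>' = "\<lambda>t. - sin (real k * t) * real k" and r = R])
    have per: "sin (real k * (2 * pi)) = 0" "cos (real k * (2 * pi)) = 1"
      using sin_int_2pin[of "int k"] cos_int_2pin[of "int k"] by (simp_all add: mult_ac)
    show "cos (real k * (2 * pi)) = cos (real k * 0)"
      "- sin (real k * (2 * pi)) * real k = - sin (real k * 0) * real k"
      by (simp_all add: per)
    show "((\<lambda>t. cos (real k * t)) has_real_derivative - sin (real k * t) * real k) (at t)" for t
      by (auto intro!: derivative_eq_intros)
    show "((\<lambda>t. - sin (real k * t) * real k) has_real_derivative - (real k)\<^sup>2 * cos (real k * t)) (at t)" for t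
      by (auto intro!: derivative_eq_intros simp: power2_eq_square)
    have "integral {0..2 * pi} (\<lambda>t. cos (real k * t) * cos (real k * t)) \<noteq> 0"
    proof
      assume "integral {0..2 * pi} (\<lambda>t. cos (real k * t) * cos (real k * t)) = 0"
      then have "\<forall>t\<in>{0..2 * pi}. cos (real k * t) * cos (real k * t) = 0"
        by (subst (asm) integral_eq_0_iff) (auto intro!: continuous_intros)
      from this[rule_format, of 0] show False
        by simp
    qed
    moreover have "?u (polar R t) * cos (real k * t)
        = - (profile k 1 ?y * (sin R)\<^sup>2 / real k * ?T ^ k) * (cos (real k * t) * cos (real k * t))" for t
      by (simp add: uR)
    ultimately show "mode (\<lambda>t. cos (real k * t)) ?u R \<noteq> 0"
      unfolding mode_def using c0 h(1) by (simp only: integral_mult_right) simp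
  qed (use R in auto)
  ultimately show ?thesis
    unfolding steklov_spectrum_def by blast
qed

section \<open>The eigenvalue zero and the full list\<close>

lemma sphere_laplacian_const [simp]: "sphere_laplacian (\<lambda>x. c) = (\<lambda>x. 0)"
proof -
  have "grad (\<lambda>x::real^3. c) = (\<lambda>x. 0)"
    by (simp add: grad_def[abs_def])
  then show ?thesis
    by (simp add: sphere_laplacian_def sphere_div_def[abs_def] sphere_grad_def[abs_def])
qed

lemma normal_deriv_const [simp]: "normal_deriv p R (\<lambda>x. c) x = 0"
  by (simp add: normal_deriv_def sphere_grad_def grad_def)

text \<open>The construction for positive frequencies divides by \<open>k\<close>; for frequency
  \<open>0\<close> a constant function does the job.\<close>

lemma zero_in_spectrum:
  assumes R: "0 < R" "R < pi"
  shows "0 \<in> steklov_spectrum p R"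
proof -
  have "\<exists>U. open U \<and> geodesic_disk p R \<subseteq> U \<and> smooth_on U (\<lambda>x::real^3. 1::real)"
    by (intro exI[of _ UNIV]) (auto intro: smooth_on_const)
  moreover have "polar R 0 \<in> geodesic_disk p R"
    using polar_in_disk R by simp
  ultimately have "steklov_eigenfunction p R 0 (\<lambda>x. 1)"
    unfolding steklov_eigenfunction_def by auto
  then show ?thesis
    unfolding steklov_spectrum_def by blast
qed

lemma steklov_eigenvalue_eq:
  assumes R: "0 < R" "R < pi"
  shows "steklov_eigenvalue p R m = steklov_xi m R"
proof -
  have "steklov_xi k R \<in> steklov_spectrum p R" for k
    using steklov_xi_in_spectrum[OF R, of k] zero_in_spectrum[OF R]
    by (cases "k = 0") (auto simp: steklov_xi_def)
  then have "range (\<lambda>k. steklov_xi k R) = steklov_spectrum p R"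
    using steklov_spectrum_subset[OF R] by blast
  moreover note mono = strict_mono_steklov_xi[OF R]
  ultimately have "steklov_eigenvalue p R = (\<lambda>k. steklov_xi k R)"
    unfolding steklov_eigenvalue_def
    by (intro the_equality) (simp, metis strict_mono_range_unique)
  then show ?thesis
    by simp
qed

end

theorem theorem3:
  fixes p :: "real^3" and m :: nat
  assumes "p \<in> sphere 0 1" and "m \<ge> 1"
  shows "strict_mono_on {0<..<pi} (\<lambda>R. steklov_eigenvalue p R m * R ^ 3) \<and>
    strict_antimono_on {0<..<pi} (\<lambda>R. steklov_eigenvalue p R m * sin R ^ 3) \<and>
    strict_mono_on {0<..<pi} (\<lambda>R. steklov_eigenvalue p R m * tan (R / 2) ^ 3) \<and>
    strict_mono_on {0<..<pi} (\<lambda>R. steklov_eigenvalue p R m * sin (R / 2) ^ 3)"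
proof -
  obtain e1 e2 where "sphere_frame p e1 e2"
    using sphere_frame_exists[OF assms(1)] .
  then have "steklov_eigenvalue p R m = steklov_xi m R" if "0 < R" "R < pi" for R
    using sphere_frame.steklov_eigenvalue_eq that by blast
  then show ?thesis
    using xi_cube_increasing[OF assms(2)] xi_sin_cube_decreasing[OF assms(2)]
      xi_tan_half_cube_increasing[OF assms(2)] xi_sin_half_cube_increasing[OF assms(2)]
    by (simp add: monotone_on_def)
qed

end
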